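(* There is an absolute constant $C>0$ such that for all integers $n,m\ge 1$ and every deque sequence $S$ of length $m$ on $[n]$, the point set $P$ produced by \textsc{Greedy} on $S$ satisfies $|P|\le C\left(m\,2^{\alpha(m,n+m)}+n\right)$, where $\alpha$ is the two-parameter inverse Ackermann function. That is, the cost of executing a deque sequence of length $m$ on $[n]$ by \textsc{Greedy} is $O(m2^{\alpha(m,n+m)}+n)$.
   Context: Update sequences. An update sequence of length $m$ on $[n]=\{1,\dots,n\}$ is $S=\langle (s_1,\mathrm{op}_1),\dots,(s_m,\mathrm{op}_m)\rangle$ with $s_t\in[n]$ and $\mathrm{op}_t\in\{\mathtt{access},\mathtt{insert},\mathtt{delete}\}$. Standing assumptions: for each element, its insertions and deletions alternate along $S$, and every $x\in[n]$ occurs in $S$. Let $K_0$ be the set of elements whose first operation in $S$ is not an insertion, and $K_t=K_{t-1}\cup\{s_t\}$ if $\mathrm{op}_t=\mathtt{insert}$, $K_t=K_{t-1}\setminus\{s_t\}$ if $\mathrm{op}_t=\mathtt{delete}$, $K_t=K_{t-1}$ otherwise. $S$ is a deque sequence if it has no access operations, every insertion at time $t$ has $s_t=\min K_t$ or $s_t=\max K_t$, and every deletion at time $t$ has $s_t=\min K_{t-1}$ or $s_t=\max K_{t-1}$. Geometric view. Points are $p=(p_x,p_t)\in[n]\times[m]$ (column $p_x$ = element, row $p_t$ = time). Let $I=\{(s_t,t):\mathrm{op}_t=\mathtt{insert}\}$, $D=\{(s_t,t):\mathrm{op}_t=\mathtt{delete}\}$, $A=\{(s_t,t):\mathrm{op}_t=\mathtt{access}\}$,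 $U=I\cup D$, $P(S)=A\cup I\cup D$. For a point $p$, let $p'$ (resp. $p''$) be the point of $U$ in column $p_x$ with the largest time $<p_t$ (resp. smallest time $>p_t$), if it exists. $p$ is valid iff either (1) $p\notin U$, $p'\in I$ or nonexistent, and $p''\in D$ or nonexistent; or (2) $p\in I$, $p'\in D$ or nonexistent, and $p''\in D$ or nonexistent; or (3) $p\in D$, $p'\in I$ or nonexistent, and $p''\in I$ or nonexistent. For a valid point $p$, its active time is the maximal interval of consecutive integers containing $p_t$ such that $(p_x,t)$ is valid for every $t$ in it. Two points $p,q$ with $p_t\le q_t$ form an active pair if every time in $[p_t,q_t]$ lies in the active times of both $p$ and $q$. For a point $p$, $\mathrm{pred}(p)$ is the point $(x',p_t)$ where $x'$ is the largest $x'<p_x$ with $(x',p_t)$ valid (if any); $\mathrm{succ}(p)$ is symmetric (smallest $x'>p_x$). $\square_{pq}$ is the closed axis-parallel rectangle with opposite corners $p,q$. \textsc{Greedy}. It processes $t=1,\dots,m$ in order and builds $P$ row by row; let $P_{<t}$ be the set of points placed in rows $1,\dots,t-1$. For a valid point $u$ in row $t$, $\mathrm{stair}(u)=\{u\}\cup\{q\in P_{<t}: u,q \text{ form an active pair and } \square_{uq}\cap P_{<t}=\{q\}\}$. Let $p=(s_t,t)$. If $\mathrm{op}_t=\mathtt{access}$, or $p\in U$ and not both $\mathrm{pred}(p),\mathrm{succ}(p)$ exist, row $t$ of $P$ is $\{(q_x,t):q\in\mathrm{stair}(p)\}$. If $p\in U$ and both exist, row $t$ is the smaller (ties arbitrary)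 of $\{(q_x,t):q\in\mathrm{stair}(p)\cup\mathrm{stair}(\mathrm{pred}(p))\}$ and $\{(q_x,t):q\in\mathrm{stair}(p)\cup\mathrm{stair}(\mathrm{succ}(p))\}$. The cost of \textsc{Greedy} on $S$ is $|P|$. *)

theory Defs
  imports Complex_Main
begin

text \<open>
  Tarjan's variant of the inverse Ackermann function. Since the column argument is \<open>4 * \<lceil>m / n\<rceil> \<ge> 4\<close> for positive \<open>m\<close> and \<open>n\<close>,
  the minimum also exists for \<open>m < n\<close>; with \<open>\<lfloor>m / n\<rfloor>\<close> in its place the minimum would be
  over an empty set when \<open>m < n\<close>. The other common variants differ from it by an additive constant.
\<close>

fun ackermann :: "nat \<Rightarrow> nat \<Rightarrow> nat" where
  "ackermann 0 x = 2 * x"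
| "ackermann (Suc i) 0 = 0"
| "ackermann (Suc i) (Suc 0) = 2"
| "ackermann (Suc i) (Suc (Suc x)) = ackermann i (ackermann (Suc i) (Suc x))"

definition inv_ackermann :: "nat \<Rightarrow> nat \<Rightarrow> nat" where
  "inv_ackermann m n =
     (LEAST z. z \<ge> 1 \<and> real (ackermann z (4 * nat \<lceil>real m / real n\<rceil>)) > log 2 (real n))"

datatype operation = Access | Insert | Delete

type_synonym update_seq = "(nat \<times> operation) list"

text \<open>Times are counted from 1: the operation at time \<open>t\<close> is \<open>S ! (t - 1)\<close>.\<close>

definition elem_at :: "update_seq \<Rightarrow> nat \<Rightarrow> nat" where
  "elem_at S t = fst (S ! (t - 1))"

definition op_at :: "update_seq \<Rightarrow> nat \<Rightarrow> operation" where
  "op_at S t = snd (S ! (t - 1))"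

definition update_sequence :: "nat \<Rightarrow> update_seq \<Rightarrow> bool" where
  "update_sequence n S \<longleftrightarrow>
     fst ` set S = {1..n} \<and>
     (\<forall>x\<in>{1..n}. distinct_adj (map snd (filter (\<lambda>(y, oper). y = x \<and> oper \<noteq> Access) S)))"

text \<open>Here \<^term>\<open>map_of S x\<close> is the first operation on \<open>x\<close> in \<open>S\<close>.\<close>

fun keys :: "nat \<Rightarrow> update_seq \<Rightarrow> nat \<Rightarrow> nat set" where
  "keys n S 0 = {x \<in> {1..n}. map_of S x \<noteq> Some Insert}"
| "keys n S (Suc t) =
     (case op_at S (Suc t) of
        Insert \<Rightarrow> keys n S t \<union> {elem_at S (Suc t)}
      | Delete \<Rightarrow> keys n S t - {elem_at S (Suc t)}
      | Access \<Rightarrow> keys n S t)"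

definition deque_sequence :: "nat \<Rightarrow> update_seq \<Rightarrow> bool" where
  "deque_sequence n S \<longleftrightarrow>
     update_sequence n S \<and>
     (\<forall>t\<in>{1..length S}.
        op_at S t \<noteq> Access \<and>
        (op_at S t = Insert \<longrightarrow>
           elem_at S t = Min (keys n S t) \<or> elem_at S t = Max (keys n S t)) \<and>
        (op_at S t = Delete \<longrightarrow>
           elem_at S t = Min (keys n S (t - 1)) \<or> elem_at S t = Max (keys n S (t - 1))))"

text \<open>A point is a pair (column, row), that is (element, time).\<close>

type_synonym point = "nat \<times> nat"

definition op_points :: "operation \<Rightarrow> update_seq \<Rightarrow> point set" where
  "op_points oper S = {(elem_at S t, t) | t. t \<in> {1..length S} \<and> op_at S t = oper}"

abbreviation ins_points :: "update_seq \<Rightarrow> point set" where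
  "ins_points \<equiv> op_points Insert"

abbreviation del_points :: "update_seq \<Rightarrow> point set" where
  "del_points \<equiv> op_points Delete"

definition upd_points :: "update_seq \<Rightarrow> point set" where
  "upd_points S = ins_points S \<union> del_points S"

definition prev_upd :: "update_seq \<Rightarrow> point \<Rightarrow> point option" where
  "prev_upd S p =
     (let T = {t. t < snd p \<and> (fst p, t) \<in> upd_points S}
      in if T = {} then None else Some (fst p, Max T))"

definition next_upd :: "update_seq \<Rightarrow> point \<Rightarrow> point option" where
  "next_upd S p =
     (let T = {t. t > snd p \<and> (fst p, t) \<in> upd_points S}
      in if T = {} then None else Some (fst p, Min T))"

text \<open>
  The inclusion \<^term>\<open>set_option (prev_upd S p) \<subseteq> ins_points S\<close> says that the previous
  update point is an insertion or does not exist.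
\<close>

definition valid :: "nat \<Rightarrow> update_seq \<Rightarrow> point \<Rightarrow> bool" where
  "valid n S p \<longleftrightarrow>
     p \<in> {1..n} \<times> {1..length S} \<and>
     (p \<notin> upd_points S \<and> set_option (prev_upd S p) \<subseteq> ins_points S
                       \<and> set_option (next_upd S p) \<subseteq> del_points S \<or>
      p \<in> ins_points S \<and> set_option (prev_upd S p) \<subseteq> del_points S
                       \<and> set_option (next_upd S p) \<subseteq> del_points S \<or>
      p \<in> del_points S \<and> set_option (prev_upd S p) \<subseteq> ins_points S
                       \<and> set_option (next_upd S p) \<subseteq> ins_points S)"

text \<open>
  The union of all intervals of valid times around \<open>p\<close> is the maximal such interval. It is empty
  if \<open>p\<close> is not valid, so that both points of an active pair are valid.
\<close>

definition active_time :: "nat \<Rightarrow> update_seq \<Rightarrow> point \<Rightarrow> nat set" where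
  "active_time n S p =
     \<Union> {{a..b} | a b. snd p \<in> {a..b} \<and> (\<forall>t\<in>{a..b}. valid n S (fst p, t))}"

definition active_pair :: "nat \<Rightarrow> update_seq \<Rightarrow> point \<Rightarrow> point \<Rightarrow> bool" where
  "active_pair n S p q \<longleftrightarrow>
     {min (snd p) (snd q)..max (snd p) (snd q)} \<subseteq> active_time n S p \<inter> active_time n S q"

definition pred_point :: "nat \<Rightarrow> update_seq \<Rightarrow> point \<Rightarrow> point option" where
  "pred_point n S p =
     (let X = {x. x < fst p \<and> valid n S (x, snd p)}
      in if X = {} then None else Some (Max X, snd p))"

definition succ_point :: "nat \<Rightarrow> update_seq \<Rightarrow> point \<Rightarrow> point option" where
  "succ_point n S p =
     (let X = {x. x > fst p \<and> valid n S (x, snd p)}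
      in if X = {} then None else Some (Min X, snd p))"

definition rect :: "point \<Rightarrow> point \<Rightarrow> point set" where
  "rect p q = {min (fst p) (fst q)..max (fst p) (fst q)} \<times> {min (snd p) (snd q)..max (snd p) (snd q)}"

text \<open>In the following, \<open>P\<close> is the set of points placed in the rows before the current row \<open>t\<close>.\<close>

definition stair :: "nat \<Rightarrow> update_seq \<Rightarrow> point set \<Rightarrow> point \<Rightarrow> point set" where
  "stair n S P u = {u} \<union> {q \<in> P. active_pair n S u q \<and> rect u q \<inter> P = {q}}"

definition project :: "nat \<Rightarrow> point set \<Rightarrow> point set" where
  "project t Q = (\<lambda>q. (fst q, t)) ` Q"

text \<open>The set of admissible choices for row \<open>t\<close>; it has two elements only in the case of a tie.\<close>

definition greedy_rows :: "nat \<Rightarrow> update_seq \<Rightarrow> nat \<Rightarrow> point set \<Rightarrow> point set set" where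
  "greedy_rows n S t P =
     (let p = (elem_at S t, t)
      in if p \<in> upd_points S
         then (case (pred_point n S p, succ_point n S p) of
                 (Some l, Some r) \<Rightarrow>
                   (let L = project t (stair n S P p \<union> stair n S P l);
                        R = project t (stair n S P p \<union> stair n S P r)
                    in {X \<in> {L, R}. card X \<le> card L \<and> card X \<le> card R})
               | _ \<Rightarrow> {project t (stair n S P p)})
         else {project t (stair n S P p)})"

text \<open>
  Ties are broken arbitrarily, so the algorithm is a relation: \<open>greedy_upto n S t P\<close> holds if
  \<open>P\<close> is a possible set of points in the rows \<open>1, \<dots>, t\<close>.
\<close>

inductive greedy_upto :: "nat \<Rightarrow> update_seq \<Rightarrow> nat \<Rightarrow> point set \<Rightarrow> bool"
  for n :: nat and S :: update_seq where
  start: "greedy_upto n S 0 {}"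
| row: "greedy_upto n S t P \<Longrightarrow> t < length S \<Longrightarrow> R \<in> greedy_rows n S (Suc t) P
        \<Longrightarrow> greedy_upto n S (Suc t) (P \<union> R)"

definition greedy :: "nat \<Rightarrow> update_seq \<Rightarrow> point set \<Rightarrow> bool" where
  "greedy n S P \<longleftrightarrow> greedy_upto n S (length S) P"

end

theory Submission
  imports Defs
begin

text \<open>
  In a deque sequence the updated element is always an extreme valid element, so each row is a single
  stair: an operation at the left end touches the elements whose last touch is a left-to-right
  record. Hence between two columns touched in the same row nothing is touched until one of these
  columns dies. Up to \<open>O(m + n)\<close> points, every touch of a column is followed by another touch of it;
  by reflection consider the touches whose successor is caused by an operation at the left end. The
  columns touched in this way in one row die in order from left to right, and each is touched again only
  after the previous one has died.

  Replace each such point in row \<open>b\<close> by the arc from \<open>b\<close> to the death time of its column. Two arcs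
  \<open>b \<rightarrow> c\<close> and \<open>b \<rightarrow> e\<close> with \<open>c < e\<close> exclude all arcs from a row in \<open>(b, c)\<close> to a time in
  \<open>(c, e]\<close>. Cut the time line into blocks of length \<open>s\<close>. Among the rows with an arc leaving their block,
  all but \<open>O(1)\<close> arcs per row and per time are the only arc of their row into the block of their head, and
  contracting the blocks turns these into a system of the same kind. Rows without an arc leaving
  their block are treated recursively. Since the constant is charged to a row only once, taking for
  \<open>s\<close> a value of the next Ackermann row costs an additive constant per row, and a factor 2 per time.
\<close>

section \<open>Sparse systems of arcs\<close>

text \<open>
  Row \<open>i\<close> sits at position \<open>p i\<close> and has arcs to the positions in \<open>T i\<close>. Positions may repeat, because
  contracting blocks moves all rows of a block to the same position while it keeps their order.
\<close>

definition sparse_rows :: "nat set \<Rightarrow> (nat \<Rightarrow> nat) \<Rightarrow> (nat \<Rightarrow> nat set) \<Rightarrow> nat \<Rightarrow> bool" where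
  "sparse_rows I p T r \<longleftrightarrow> finite I \<and> (\<forall>i\<in>I. T i \<subseteq> {p i<..<r}) \<and>
     (\<forall>i\<in>I. \<forall>j\<in>I. \<forall>c\<in>T i. \<forall>e\<in>T i. i < j \<and> p j < c \<longrightarrow> T j \<inter> {c<..e} = {})"

lemma sparse_rows_subset: "sparse_rows I p T r \<Longrightarrow> J \<subseteq> I \<Longrightarrow> sparse_rows J p T r"
  unfolding sparse_rows_def by (meson finite_subset subsetD)

lemma sparse_rows_range: "sparse_rows I p T r \<Longrightarrow> i \<in> I \<Longrightarrow> e \<in> T i \<Longrightarrow> p i < e \<and> e < r"
  unfolding sparse_rows_def by (meson greaterThanLessThan_iff subsetD)

lemma sparse_rows_finite: "sparse_rows I p T r \<Longrightarrow> i \<in> I \<Longrightarrow> finite (T i)"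
  unfolding sparse_rows_def by (meson finite_greaterThanLessThan finite_subset)

lemma sparse_rowsD:
  assumes "sparse_rows I p T r" "i \<in> I" "j \<in> I" "i < j" "c \<in> T i" "e \<in> T i" "p j < c"
    "c < x" "x \<le> e"
  shows "x \<notin> T j"
  using assms unfolding sparse_rows_def by (metis disjoint_iff greaterThanAtMost_iff)

section \<open>Counting arcs by the blocks of their heads\<close>

lemma sum_card_disjoint_le:
  fixes E :: "nat \<Rightarrow> 'a set"
  assumes "finite I" "finite U" "\<And>i. i \<in> I \<Longrightarrow> E i \<subseteq> U"
    and "\<And>i j. i \<in> I \<Longrightarrow> j \<in> I \<Longrightarrow> i < j \<Longrightarrow> E i \<inter> E j = {}"
  shows "(\<Sum>i\<in>I. card (E i)) \<le> card U"
proof -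
  have "(\<Sum>i\<in>I. card (E i)) = card (\<Union>i\<in>I. E i)"
    using assms by (intro card_UN_disjoint[symmetric])
      (auto intro: finite_subset simp: disjoint_iff, metis nat_neq_iff)
  also have "\<dots> \<le> card U" using assms by (intro card_mono) auto
  finally show ?thesis .
qed

text \<open>
  The blocks that receive exactly one arc from a row at position \<open>q\<close>. Requiring an arc beyond the block
  keeps \<open>sparse_rows\<close> intact under contraction: it covers the part of the block to the right of the
  head.
\<close>

definition blocks :: "nat \<Rightarrow> nat set \<Rightarrow> nat \<Rightarrow> nat set" where
  "blocks s A q = {y. q div s < y \<and> (\<exists>e. A \<inter> {x. x div s = y} = {e}) \<and> (\<exists>f\<in>A. y < f div s)}"

text \<open>An arc outside \<open>E1\<close> and \<open>E2\<close> is the last one in the block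
  \<open>q div s\<close>, the first one in the last block that \<open>A\<close> reaches, or the only
  arc into a block strictly between. The first two cases give one arc each, hence the 2.\<close>

lemma card_row_le:
  assumes fin: "finite A" and gt: "\<And>e. e \<in> A \<Longrightarrow> q < e" and out: "\<exists>g\<in>A. g div s \<noteq> q div s"
  defines "E1 \<equiv> {e \<in> A. \<exists>f\<in>A. \<exists>g\<in>A. e < f \<and> f div s = e div s \<and> e div s < g div s}"
    and "E2 \<equiv> {e \<in> A. \<exists>c\<in>A. c < e \<and> c div s = e div s \<and> q div s < e div s}"
  shows "card A \<le> card E1 + card E2 + card (blocks s A q) + 2"
proof -
  let ?G = "{e\<in>A. e div s \<in> blocks s A q}"
  let ?a = "Max {e\<in>A. e div s = q div s}"
  let ?b = "Min {e\<in>A. e div s = Max A div s}"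
  have ge: "q div s \<le> e div s" if "e \<in> A" for e using gt[OF that] by (simp add: div_le_mono)
  have le: "e div s \<le> Max A div s" if "e \<in> A" for e using that fin by (simp add: div_le_mono)
  have "A \<noteq> {}" using out by auto
  then have MA: "Max A \<in> A" using fin by simp
  have sub: "A \<subseteq> E1 \<union> E2 \<union> ?G \<union> {?a, ?b}"
  proof
    fix e assume e: "e \<in> A"
    show "e \<in> E1 \<union> E2 \<union> ?G \<union> {?a, ?b}"
    proof (rule ccontr)
      assume n: "\<not> ?thesis"
      then have n1: "e \<notin> E1" and n2: "e \<notin> E2" and n3: "e \<notin> ?G" and n4: "e \<noteq> ?a" "e \<noteq> ?b" by auto
      show False
      proof (cases "e div s = q div s")
        case True
        obtain g where g: "g \<in> A" "g div s \<noteq> q div s" using out by auto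
        then have "e div s < g div s" using ge[of g] True by simp
        then have "\<forall>f\<in>A. f div s = e div s \<longrightarrow> f \<le> e"
          using n1 e g unfolding E1_def mem_Collect_eq by (meson not_le)
        then have "?a = e" using e True fin by (intro Max_eqI) auto
        then show False using n4 by simp
      next
        case False
        then have lt: "q div s < e div s" using ge[OF e] by simp
        then have mn: "\<forall>c\<in>A. c div s = e div s \<longrightarrow> e \<le> c"
          using n2 e unfolding E2_def mem_Collect_eq by (meson not_le)
        show False
        proof (cases "e div s = Max A div s")
          case True
          then have "?b = e" using e mn fin by (intro Min_eqI) auto
          then show False using n4 by simp
        next
          case False
          then have lt2: "e div s < Max A div s" using le[OF e] by simp
          then have "\<forall>f\<in>A. f div s = e div s \<longrightarrow> f \<le> e"
            using n1 e MA unfolding E1_def mem_Collect_eq by (meson not_le)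
          then have "A \<inter> {x. x div s = e div s} = {e}" using mn e by (auto intro: antisym)
          then have "e div s \<in> blocks s A q" unfolding blocks_def using lt lt2 MA by blast
          then show False using n3 e by simp
        qed
      qed
    qed
  qed
  have inj: "inj_on (\<lambda>e. e div s) ?G" unfolding blocks_def inj_on_def
    by (auto, metis (mono_tags, lifting) Int_iff mem_Collect_eq singletonD)
  have fb: "finite (blocks s A q)"
  proof (rule finite_subset)
    show "blocks s A q \<subseteq> (\<lambda>e. e div s) ` A"
    proof
      fix y assume "y \<in> blocks s A q"
      then obtain e where "A \<inter> {x. x div s = y} = {e}" unfolding blocks_def by blast
      then have "e \<in> A \<and> e div s = y" by blast
      then show "y \<in> (\<lambda>e. e div s) ` A" by blast
    qed
  qed (use fin in simp)
  have cG: "card ?G \<le> card (blocks s A q)"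
    by (rule card_inj_on_le[OF inj _ fb]) auto
  have "card A \<le> card (E1 \<union> E2 \<union> ?G \<union> {?a, ?b})"
    by (rule card_mono[OF _ sub]) (auto simp: fin E1_def E2_def)
  also have "\<dots> \<le> card (E1 \<union> E2 \<union> ?G) + card {?a, ?b}" by (rule card_Un_le)
  also have "\<dots> \<le> card E1 + card E2 + card ?G + 2"
    using card_Un_le[of "E1 \<union> E2" ?G] card_Un_le[of E1 E2] card_insert_le_m1[of 2 "{?b}" ?a] by simp
  finally show ?thesis using cG by simp
qed

text \<open>Each time lies in at most one \<open>E1\<close> set and at most one \<open>E2\<close>
  set, which costs \<open>2 * r\<close>; the two exceptional arcs of \<open>card_row_le\<close> cost
  2 per row. Only rows outside \<open>L\<close> pay this, so a recursion on \<open>L\<close> charges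
  no row twice.\<close>

lemma block_split:
  fixes s :: nat
  assumes S: "sparse_rows I p T r"
  defines "L \<equiv> {i\<in>I. \<forall>e\<in>T i. e div s = p i div s}"
  shows "(\<Sum>i\<in>I. card (T i)) \<le> (\<Sum>i\<in>L. card (T i)) + (\<Sum>i\<in>I - L. card (blocks s (T i) (p i)))
    + 2 * card (I - L) + 2 * r"
proof -
  let ?E1 = "\<lambda>i. {e \<in> T i. \<exists>f\<in>T i. \<exists>g\<in>T i. e < f \<and> f div s = e div s \<and> e div s < g div s}"
  let ?E2 = "\<lambda>i. {e \<in> T i. \<exists>c\<in>T i. c < e \<and> c div s = e div s \<and> p i div s < e div s}"
  have fI: "finite I" using S unfolding sparse_rows_def by simp
  have ltI: "e < g" if "e div s < g div s" for e g :: nat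
    using that by (meson div_le_mono leD leI)
  have s1: "(\<Sum>i\<in>I - L. card (?E1 i)) \<le> card {..<r}"
  proof (rule sum_card_disjoint_le)
    show "?E1 i \<subseteq> {..<r}" if "i \<in> I - L" for i using sparse_rows_range[OF S] that by auto
    show "?E1 i \<inter> ?E1 j = {}" if i: "i \<in> I - L" and j: "j \<in> I - L" and ij: "i < j" for i j
    proof (rule ccontr)
      assume "\<not> ?thesis"
      then obtain e f g f' where *: "e \<in> T i" "g \<in> T i" "e div s < g div s"
        "e \<in> T j" "f' \<in> T j" "e < f'" "f' div s = e div s" by blast
      \<comment> \<open>Row \<open>i\<close> spans from \<open>e\<close> to \<open>g\<close> in a
        later block, and the second arc \<open>f'\<close> of row \<open>j\<close> stays in the block
        of \<open>e\<close>, hence inside this span.\<close>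
      have "p j < e" using sparse_rows_range[OF S] * j by auto
      moreover have "f' \<le> g" using ltI[of f' g] * by simp
      ultimately show False using sparse_rowsD[OF S, of i j e g f'] i j ij * by auto
    qed
  qed (use fI in auto)
  have s2: "(\<Sum>i\<in>I - L. card (?E2 i)) \<le> card {..<r}"
  proof (rule sum_card_disjoint_le)
    show "?E2 i \<subseteq> {..<r}" if "i \<in> I - L" for i using sparse_rows_range[OF S] that by auto
    show "?E2 i \<inter> ?E2 j = {}" if i: "i \<in> I - L" and j: "j \<in> I - L" and ij: "i < j" for i j
    proof (rule ccontr)
      assume "\<not> ?thesis"
      then obtain e c where *: "e \<in> T i" "c \<in> T i" "c < e" "c div s = e div s"
        "e \<in> T j" "p j div s < e div s" by blast
      \<comment> \<open>The block of \<open>c\<close> and \<open>e\<close> begins after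
        \<open>p j\<close>, so the pair \<open>c\<close>, \<open>e\<close> of row \<open>i\<close>
        forbids the head \<open>e\<close> to row \<open>j\<close>.\<close>
      then have "p j < c" using ltI[of "p j" c] by simp
      then show False using sparse_rowsD[OF S, of i j c e e] i j ij * by auto
    qed
  qed (use fI in auto)
  have "(\<Sum>i\<in>I - L. card (T i)) \<le> (\<Sum>i\<in>I - L. card (?E1 i) + card (?E2 i) + card (blocks s (T i) (p i)) + 2)"
  proof (rule sum_mono)
    fix i assume i: "i \<in> I - L"
    then have "i \<in> I" by simp
    then show "card (T i) \<le> card (?E1 i) + card (?E2 i) + card (blocks s (T i) (p i)) + 2"
      using card_row_le[OF sparse_rows_finite[OF S], of i "p i" s] sparse_rows_range[OF S, of i] i
      unfolding L_def by auto
  qed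
  also have "\<dots> \<le> (\<Sum>i\<in>I - L. card (blocks s (T i) (p i))) + 2 * card (I - L) + 2 * r"
    using s1 s2 unfolding sum.distrib by simp
  finally have "(\<Sum>i\<in>I - L. card (T i)) \<le> \<dots>" .
  moreover have "(\<Sum>i\<in>I. card (T i)) = (\<Sum>i\<in>L. card (T i)) + (\<Sum>i\<in>I - L. card (T i))"
    using fI sum.subset_diff[of L I "\<lambda>i. card (T i)"] unfolding L_def by auto
  ultimately show ?thesis by simp
qed

text \<open>A violation among blocks lifts to one among arcs: with heads \<open>c\<close> and
  \<open>w\<close> in the blocks \<open>Y < W\<close>, and \<open>f\<close> beyond \<open>Z\<close>,
  the order is \<open>c\<close>, \<open>w\<close>, \<open>f\<close>.\<close>

lemma sparse_rows_blocks:
  assumes S: "sparse_rows I p T r" and q: "r \<le> q * s"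
  shows "sparse_rows I (\<lambda>i. p i div s) (\<lambda>i. blocks s (T i) (p i)) q"
proof -
  have ltI: "e < g" if "e div s < g div s" for e g :: nat
    using that by (meson div_le_mono leD leI)
  have "y < q" if iy: "i \<in> I" "y \<in> blocks s (T i) (p i)" for i y
  proof -
    obtain f where "f \<in> T i" "y < f div s" using iy unfolding blocks_def by blast
    moreover have "f div s < q" using sparse_rows_range[OF S, of i f] \<open>f \<in> T i\<close> iy q
      by (simp add: less_mult_imp_div_less)
    ultimately show ?thesis by simp
  qed
  moreover have "blocks s (T j) (p j) \<inter> {Y<..Z} = {}"
    if *: "i \<in> I" "j \<in> I" "i < j" "Y \<in> blocks s (T i) (p i)" "Z \<in> blocks s (T i) (p i)"
      "p j div s < Y" for i j Y Z
  proof (rule ccontr)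
    assume "\<not> ?thesis"
    then obtain W where W: "W \<in> blocks s (T j) (p j)" "Y < W" "W \<le> Z" by auto
    obtain c where c: "c \<in> T i" "c div s = Y" using * unfolding blocks_def by blast
    obtain f where f: "f \<in> T i" "Z < f div s" using * unfolding blocks_def by blast
    obtain w where w: "w \<in> T j" "w div s = W" using W unfolding blocks_def by blast
    have "p j < c" using ltI[of "p j" c] *(6) c(2) by metis
    moreover have "c < w" using ltI[of c w] W(2) c(2) w(2) by metis
    moreover have "w < f" using ltI[of w f] le_less_trans[OF W(3) f(2)] w(2) by metis
    ultimately show False using sparse_rowsD[OF S *(1-3) c(1) f(1), of w] w(1) by simp
  qed
  moreover have "p i div s < y" if "y \<in> blocks s (T i) (p i)" for i y
    using that unfolding blocks_def by simp
  moreover have "finite I" using S unfolding sparse_rows_def by simp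
  ultimately show ?thesis unfolding sparse_rows_def subset_iff greaterThanLessThan_iff by blast
qed

section \<open>Linear bounds for sparse systems\<close>

text \<open>The bound \<open>N\<close> limits the number of positions, while the number of rows is arbitrary.\<close>

definition rows_bound :: "nat \<Rightarrow> nat \<Rightarrow> nat \<Rightarrow> bool" where
  "rows_bound N a b \<longleftrightarrow> (\<forall>I p T r. sparse_rows I p T r \<longrightarrow> r \<le> N \<longrightarrow>
     (\<Sum>i\<in>I. card (T i)) \<le> a * card I + b * r)"

text \<open>Blocks do not interact when no arc leaves its block: cut off the first block, shift the
  rest left by \<open>s\<close>, and induct on \<open>r\<close>. The coefficients survive because
  the bound is additive in rows and positions.\<close>

lemma local_rows:
  assumes S: "sparse_rows I p T r" and s: "s > 0" and B: "rows_bound s a b"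
    and loc: "\<And>i e. i \<in> I \<Longrightarrow> e \<in> T i \<Longrightarrow> e div s = p i div s"
  shows "(\<Sum>i\<in>I. card (T i)) \<le> a * card I + b * r"
  using S loc
proof (induction r arbitrary: I p T rule: less_induct)
  case (less r)
  note S = less.prems(1) and loc = less.prems(2)
  have fI: "finite I" using S unfolding sparse_rows_def by simp
  show ?case
  proof (cases "r \<le> s")
    case True
    then show ?thesis using B S unfolding rows_bound_def by blast
  next
    case False
    let ?J = "{i\<in>I. p i < s}"
    let ?K = "I - ?J"
    have TJ: "e < s" if "i \<in> ?J" "e \<in> T i" for i e
      using loc[of i e] that s by (simp add: div_eq_0_iff)
    have "sparse_rows ?J p T s"
    proof -
      have "sparse_rows ?J p T r" by (rule sparse_rows_subset[OF S]) auto
      moreover have "T i \<subseteq> {p i<..<s}" if "i \<in> ?J" for i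
        using sparse_rows_range[OF S, of i] TJ[of i] that by auto
      ultimately show ?thesis unfolding sparse_rows_def by blast
    qed
    then have 1: "(\<Sum>i\<in>?J. card (T i)) \<le> a * card ?J + b * s"
      using B unfolding rows_bound_def by blast
    let ?T = "\<lambda>i. (\<lambda>e. e - s) ` T i"
    have TK: "s \<le> p i \<and> s \<le> e" if "i \<in> ?K" "e \<in> T i" for i e
      using sparse_rows_range[OF S, of i e] that by auto
    have SK: "sparse_rows ?K (\<lambda>i. p i - s) ?T (r - s)"
      unfolding sparse_rows_def
    proof (intro conjI ballI impI)
      fix i assume "i \<in> ?K"
      then show "?T i \<subseteq> {p i - s<..<r - s}" using TK[of i] sparse_rows_range[OF S, of i] by fastforce
    next
      fix i j c e assume *: "i \<in> ?K" "j \<in> ?K" "c \<in> ?T i" "e \<in> ?T i" "i < j \<and> p j - s < c"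
      then obtain c' e' where ce: "c' \<in> T i" "c = c' - s" "e' \<in> T i" "e = e' - s" by auto
      show "?T j \<inter> {c<..e} = {}"
      proof (rule ccontr)
        assume "\<not> ?thesis"
        then obtain x where x: "x \<in> T j" "c < x - s" "x - s \<le> e" by auto
        have "p j < c'" using * ce TK[of j x] TK[of i c'] x by auto
        moreover have "c' < x" "x \<le> e'"
          using ce x * TK[of i c'] TK[of i e'] TK[of j x] by linarith+
        ultimately show False using sparse_rowsD[OF S, of i j c' e' x] * ce x by auto
      qed
    qed (use fI in auto)
    have "(\<Sum>i\<in>?K. card (?T i)) \<le> a * card ?K + b * (r - s)"
    proof (rule less.IH[OF _ SK])
      show "r - s < r" using False s by simp
      fix i e assume i: "i \<in> ?K" and "e \<in> ?T i"
      then obtain e' where e: "e' \<in> T i" "e = e' - s" by auto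
      have "e' div s = p i div s" using loc[of i e'] i e by simp
      moreover have "(x - s) div s = x div s - 1" if "s \<le> x" for x
        using le_div_geq[OF s that] by simp
      ultimately show "e div s = (p i - s) div s" using TK[of i e'] i e by simp
    qed
    moreover have "card (?T i) = card (T i)" if "i \<in> ?K" for i
      by (rule card_image) (use TK[OF that] in \<open>auto simp: inj_on_def, metis le_add_diff_inverse\<close>)
    ultimately have 2: "(\<Sum>i\<in>?K. card (T i)) \<le> a * card ?K + b * (r - s)" by simp
    have c: "card I = card ?J + card ?K"
      using fI card_Un_disjoint[of ?J ?K] by (auto simp: Un_absorb1)
    have d: "(\<Sum>i\<in>I. card (T i)) = (\<Sum>i\<in>?J. card (T i)) + (\<Sum>i\<in>?K. card (T i))"
      using fI sum.subset_diff[of ?J I "\<lambda>i. card (T i)"] by auto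
    have "b * r = b * s + b * (r - s)" using False by (simp add: add_mult_distrib2[symmetric])
    then show ?thesis using 1 2 c d by (simp add: add_mult_distrib2)
  qed
qed

text \<open>The least head of a row together with a further head determines the row: a later row
  \<open>j\<close> with the same least head has \<open>p j\<close> before it, so sparsity excludes
  the further head. This gives at most \<open>r * r\<close> pairs, plus one uncounted head per
  row.\<close>

lemma rows_bound_linear: "rows_bound N 1 N"
  unfolding rows_bound_def
proof (intro allI impI)
  fix I p T r assume S: "sparse_rows I p T r" and r: "r \<le> N"
  have fI: "finite I" using S unfolding sparse_rows_def by simp
  let ?E = "\<lambda>i. {Min (T i)} \<times> (T i - {Min (T i)})"
  have fT: "finite (T i)" if "i \<in> I" for i using sparse_rows_finite[OF S that] .
  have "(\<Sum>i\<in>I. card (?E i)) \<le> card ({..<r} \<times> {..<r})"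
  proof (rule sum_card_disjoint_le)
    show "?E i \<subseteq> {..<r} \<times> {..<r}" if "i \<in> I" for i
    proof
      fix x assume x: "x \<in> ?E i"
      then have "Min (T i) \<in> T i" using fT[OF that] by (intro Min_in) auto
      then show "x \<in> {..<r} \<times> {..<r}" using x sparse_rows_range[OF S that] by auto
    qed
    show "?E i \<inter> ?E j = {}" if i: "i \<in> I" and j: "j \<in> I" and ij: "i < j" for i j
    proof (rule ccontr)
      assume "\<not> ?thesis"
      then obtain e where e: "Min (T i) = Min (T j)" "e \<in> T i" "e \<in> T j" "e \<noteq> Min (T i)" by auto
      have m: "Min (T i) \<in> T i" "Min (T j) \<in> T j"
        using Min_in[OF fT[OF i]] Min_in[OF fT[OF j]] e(2,3) by blast+
      have "Min (T i) < e" using Min_le[OF fT[OF i] e(2)] e(4) by simp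
      then show False using sparse_rowsD[OF S, of i j "Min (T i)" e e] i j ij e m
          sparse_rows_range[OF S j] by auto
    qed
  qed (use fI in auto)
  also have "\<dots> \<le> N * r" using r by simp
  finally have *: "(\<Sum>i\<in>I. card (?E i)) \<le> N * r" .
  have "(\<Sum>i\<in>I. card (T i)) \<le> (\<Sum>i\<in>I. 1 + card (?E i))"
    by (intro sum_mono) (auto simp: card_cartesian_product card_Diff_singleton_if)
  then show "(\<Sum>i\<in>I. card (T i)) \<le> 1 * card I + N * r" using * by (simp only: sum.distrib) simp
qed

section \<open>The Ackermann bound for sparse systems\<close>

lemma ackermann_ge: "2 * x \<le> ackermann i x"
proof (induction i arbitrary: x)
  case (Suc i)
  show ?case
  proof (induction x rule: induct_nat_012)
    case (ge2 x)
    then show ?case using Suc[of "ackermann (Suc i) (Suc x)"] by simp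
  qed auto
qed simp

lemma ackermann_mono: "x \<le> y \<Longrightarrow> ackermann i x \<le> ackermann i y"
proof (rule lift_Suc_mono_le[of "ackermann i"])
  fix x show "ackermann i x \<le> ackermann i (Suc x)"
  proof (cases i)
    case (Suc j)
    then show ?thesis
      using ackermann_ge[of "ackermann i x" j] by (cases x) auto
  qed simp
qed

lemma ackermann_Suc_ge: "ackermann i x \<le> ackermann (Suc i) x"
proof (induction x rule: induct_nat_012)
  case (ge2 x)
  show ?case
    using ackermann_mono[of "Suc (Suc x)" "ackermann (Suc i) (Suc x)" i] ackermann_ge[of "Suc x" "Suc i"]
    by simp
qed (cases i; simp)+

text \<open>With blocks of length \<open>?s\<close>, the contracted system has at most
  \<open>ackermann i ?s\<close> positions and falls under the assumption, while rows inside a block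
  fall under the induction on \<open>k\<close>. Each step in \<open>k\<close> adds
  \<open>2 * b\<close> for the contracted arcs and 2 from \<open>block_split\<close> to the
  coefficient of \<open>r\<close>.\<close>

lemma rows_bound_step:
  assumes IH: "\<And>k. rows_bound (ackermann i k) a (b * k)"
  shows "rows_bound (ackermann (Suc i) k) (a + 2) ((2 * b + 2) * k)"
proof (induction k rule: induct_nat_012)
  case 0
  then show ?case by (auto simp: rows_bound_def sparse_rows_def)
next
  case 1
  show ?case unfolding rows_bound_def
  proof (intro allI impI)
    fix I p T r assume S: "sparse_rows I p T r" and r: "r \<le> ackermann (Suc i) (Suc 0)"
    have "card (T j) \<le> 1" if "j \<in> I" for j
    proof -
      \<comment> \<open>Here \<open>r\<close> is at most 2, so 1 is the only possible head.\<close>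
      have "T j \<subseteq> {1}" using sparse_rows_range[OF S that] r by force
      then show ?thesis using card_mono[of "{1::nat}" "T j"] by simp
    qed
    then have "(\<Sum>i\<in>I. card (T i)) \<le> 1 * card I" using sum_bounded_above[of I "\<lambda>i. card (T i)" 1] by simp
    then show "(\<Sum>i\<in>I. card (T i)) \<le> (a + 2) * card I + (2 * b + 2) * Suc 0 * r" by simp
  qed
next
  case (ge2 k)
  let ?s = "ackermann (Suc i) (Suc k)"
  have s: "?s > 0" using ackermann_ge[of "Suc k" "Suc i"] by simp
  show ?case unfolding rows_bound_def
  proof (intro allI impI)
    fix I p T r assume S: "sparse_rows I p T r" and r: "r \<le> ackermann (Suc i) (Suc (Suc k))"
    show "(\<Sum>i\<in>I. card (T i)) \<le> (a + 2) * card I + (2 * b + 2) * Suc (Suc k) * r"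
    proof (cases "r \<le> ?s")
      case True
      then have "(\<Sum>i\<in>I. card (T i)) \<le> (a + 2) * card I + (2 * b + 2) * Suc k * r"
        using ge2(2) S unfolding rows_bound_def by blast
      also have "\<dots> \<le> (a + 2) * card I + (2 * b + 2) * Suc (Suc k) * r"
        by (intro add_mono mult_le_mono) auto
      finally show ?thesis .
    next
      case False
      let ?L = "{i\<in>I. \<forall>e\<in>T i. e div ?s = p i div ?s}"
      \<comment> \<open>The number of blocks, rounded up. As \<open>r\<close> exceeds
        \<open>?s\<close>, the full blocks cover at most \<open>2 * r\<close> positions, which is
        where the factor 2 comes from.\<close>
      let ?q = "(r + ?s - 1) div ?s"
      have fI: "finite I" using S unfolding sparse_rows_def by simp
      have q1: "r \<le> ?q * ?s"
        using s div_mult_mod_eq[of "r + ?s - 1" ?s] mod_less_divisor[OF s, of "r + ?s - 1"] by linarith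
      have q2: "?q * ?s \<le> 2 * r" using div_times_less_eq_dividend[of "r + ?s - 1" ?s] False by linarith
      have "?q * 2 \<le> ?q * ?s" using ackermann_ge[of "Suc k" "Suc i"] by (intro mult_le_mono) auto
      then have "?q \<le> r" using q2 by linarith
      then have q3: "?q \<le> ackermann i ?s" using r by simp
      \<comment> \<open>The assumption is used with \<open>k\<close> equal to the block length,
        which then cancels against the number of blocks.\<close>
      have "(\<Sum>i\<in>I - ?L. card (blocks ?s (T i) (p i))) \<le> a * card (I - ?L) + b * ?s * ?q"
        using IH[of ?s] sparse_rows_blocks[OF sparse_rows_subset[OF S, of "I - ?L"] q1] q3
        unfolding rows_bound_def by blast
      also have "b * ?s * ?q \<le> b * (2 * r)" using q2 by (metis mult.assoc mult.commute mult_le_mono2)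
      finally have out: "(\<Sum>i\<in>I - ?L. card (blocks ?s (T i) (p i))) \<le> a * card (I - ?L) + 2 * b * r"
        by simp
      have loc: "(\<Sum>i\<in>?L. card (T i)) \<le> (a + 2) * card ?L + ((2 * b + 2) * Suc k) * r"
        by (rule local_rows[OF sparse_rows_subset[OF S] s ge2(2)]) auto
      have c: "card I = card ?L + card (I - ?L)"
        using fI card_Un_disjoint[of ?L "I - ?L"] by (auto simp: Un_absorb1)
      have "(\<Sum>i\<in>I. card (T i)) \<le> ((a + 2) * card ?L + ((2 * b + 2) * Suc k) * r)
          + (a * card (I - ?L) + 2 * b * r) + 2 * card (I - ?L) + 2 * r"
        using block_split[OF S, of ?s] out loc by linarith
      also have "\<dots> = (a + 2) * card I + (2 * b + 2) * Suc (Suc k) * r"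
        unfolding c by (simp add: algebra_simps)
      finally show ?thesis .
    qed
  qed
qed

text \<open>Solves the recurrences \<open>a + 2\<close> and \<open>2 * b + 2\<close> from the
  initial values 1 and 2. The doubling per Ackermann row becomes the factor
  \<open>2 ^ \<alpha>\<close>.\<close>

lemma rows_bound_ackermann: "rows_bound (ackermann i k) (2 * i + 1) ((4 * 2 ^ i - 2) * k)"
proof (induction i arbitrary: k)
  case 0
  show ?case using rows_bound_linear[of "2 * k"] by simp
next
  case (Suc i)
  have "2 * (4 * 2 ^ i - 2) + 2 = (4 * 2 ^ Suc i - 2 :: nat)"
    using one_le_power[of "2::nat" i] by (simp only: power_Suc) linarith
  then show ?case using rows_bound_step[OF Suc, of k] by simp
qed

section \<open>Touches in a deque\<close>

definition alive :: "(nat \<Rightarrow> int set) \<Rightarrow> int \<Rightarrow> nat \<Rightarrow> nat \<Rightarrow> bool" where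
  "alive V y b t \<longleftrightarrow> (\<forall>v\<in>{b..t}. y \<in> V v)"

text \<open>The last row of life rather than the first row after it, so that the dying column is the
  updated element of this very row, unless the row is \<open>m\<close>.\<close>

definition death :: "nat \<Rightarrow> (nat \<Rightarrow> int set) \<Rightarrow> int \<Rightarrow> nat \<Rightarrow> nat" where
  "death m V y b = Max {t. b \<le> t \<and> t \<le> m \<and> alive V y b t}"

text \<open>Touches in different lifetimes of a column are not linked; the last touch of a lifetime
  is counted in \<open>last_touches\<close>.\<close>

definition next_touch :: "nat \<Rightarrow> (nat \<Rightarrow> int set) \<Rightarrow> (nat \<Rightarrow> int set) \<Rightarrow> int \<Rightarrow> nat \<Rightarrow> nat \<Rightarrow> bool" where
  "next_touch m V R y b t \<longleftrightarrow>
     b < t \<and> t \<le> m \<and> alive V y b t \<and> y \<in> R t \<and> (\<forall>u. b < u \<and> u < t \<longrightarrow> y \<notin> R u)"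

definition left_touched ::
  "nat \<Rightarrow> (nat \<Rightarrow> int set) \<Rightarrow> (nat \<Rightarrow> int set) \<Rightarrow> (nat \<Rightarrow> int) \<Rightarrow> nat \<Rightarrow> int set" where
  "left_touched m V R s b = {y \<in> R b. \<exists>t. next_touch m V R y b t \<and> (\<forall>v\<in>V t. s t \<le> v)}"

text \<open>\<open>V t\<close> stands for the valid columns, \<open>R t\<close> for the touched
  columns and \<open>s t\<close> for the updated column of row \<open>t\<close>. The assumption
  \<open>touch\<close> is the stair condition: an earlier touch supports the new one across an
  otherwise empty rectangle. Columns are integers so that negation exchanges left and right.\<close>

locale deque_touches =
  fixes m :: nat and V R :: "nat \<Rightarrow> int set" and s :: "nat \<Rightarrow> int"
  assumes finite_V: "t \<in> {1..m} \<Longrightarrow> finite (V t)"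
    and R_subset: "t \<in> {1..m} \<Longrightarrow> R t \<subseteq> V t"
    and s_in_R: "t \<in> {1..m} \<Longrightarrow> s t \<in> R t"
    and extreme: "t \<in> {1..m} \<Longrightarrow> (\<forall>v\<in>V t. s t \<le> v) \<or> (\<forall>v\<in>V t. v \<le> s t)"
    and leave: "1 \<le> t \<Longrightarrow> t < m \<Longrightarrow> y \<in> V t \<Longrightarrow> y \<notin> V (Suc t) \<Longrightarrow> y = s t"
    and touch: "t \<in> {1..m} \<Longrightarrow> y \<in> R t \<Longrightarrow> y \<noteq> s t \<Longrightarrow>
      \<exists>u. 1 \<le> u \<and> u < t \<and> y \<in> R u \<and> alive V y u t \<and>
        (\<forall>z v. min (s t) y \<le> z \<and> z \<le> max (s t) y \<and> u \<le> v \<and> v < t \<and> z \<in> R v \<longrightarrow> z = y \<and> v = u)"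
begin

section \<open>How a row restricts later touches\<close>

lemma in_V: "t \<in> {1..m} \<Longrightarrow> y \<in> R t \<Longrightarrow> y \<in> V t"
  using R_subset by auto

text \<open>
  Induction on \<open>t\<close>: the touch that supports \<open>x\<close> at time \<open>t\<close> is not hidden by the touches of \<open>z\<close>
  and \<open>y\<close> at time \<open>b\<close>, so it is later than \<open>b\<close>.
\<close>

lemma frozen:
  assumes b: "1 \<le> b" "z \<in> R b" "y \<in> R b" and x: "z < x" "x < y"
  shows "b < t \<Longrightarrow> t \<le> m \<Longrightarrow> alive V z b t \<Longrightarrow> alive V y b t \<Longrightarrow> x \<notin> R t"
proof (induction t rule: less_induct)
  case (less t)
  have t: "t \<in> {1..m}" using less.prems b by simp
  have zy: "z \<in> V t" "y \<in> V t" using less.prems unfolding alive_def by auto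
  show ?case
  proof
    assume xR: "x \<in> R t"
    have "x \<noteq> s t" using extreme[OF t] zy x by auto
    then obtain u where u: "1 \<le> u" "u < t" "x \<in> R u"
      and e: "\<And>z v. min (s t) x \<le> z \<Longrightarrow> z \<le> max (s t) x \<Longrightarrow> u \<le> v \<Longrightarrow> v < t \<Longrightarrow> z \<in> R v \<Longrightarrow> z = x \<and> v = u"
      using touch[OF t xR] by blast
    have "b < u"
    proof (rule ccontr)
      assume "\<not> b < u"
      then have ub: "u \<le> b" by simp
      from extreme[OF t] show False
      proof
        assume "\<forall>v\<in>V t. s t \<le> v"
        then have "s t \<le> z" using zy by simp
        then show False using e[of z b] ub less.prems b x by auto
      next
        assume "\<forall>v\<in>V t. v \<le> s t"
        then have "y \<le> s t" using zy by simp
        then show False using e[of y b] ub less.prems b x by auto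
      qed
    qed
    moreover have "alive V z b u" "alive V y b u" using less.prems u unfolding alive_def by auto
    ultimately show False using less.IH[of u] u less.prems by auto
  qed
qed

text \<open>As \<open>y\<close> is untouched between \<open>b\<close> and \<open>n\<close>, its
  support at time \<open>n\<close> is in a row \<open>u \<le> b\<close>. If \<open>z\<close> were
  alive, then \<open>s n \<le> z\<close>, and the touch of \<open>z\<close> at \<open>b\<close>
  would lie in the rectangle that must be empty apart from the support.\<close>

lemma next_left_touch:
  assumes n: "next_touch m V R y b n" "\<forall>v\<in>V n. s n \<le> v" and b: "1 \<le> b" "y \<in> R b" "z \<in> R b" "z < y"
  shows "\<not> alive V z b n"
proof
  assume z: "alive V z b n"
  have t: "n \<in> {1..m}" and bn: "b < n" and yR: "y \<in> R n"
    and no: "\<And>u. b < u \<Longrightarrow> u < n \<Longrightarrow> y \<notin> R u" using n unfolding next_touch_def by auto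
  have "z \<in> V n" using z bn unfolding alive_def by auto
  then have sz: "s n \<le> z" using n by auto
  then have "y \<noteq> s n" using b by auto
  then obtain u where u: "u < n" "y \<in> R u"
    and e: "\<And>z v. min (s n) y \<le> z \<Longrightarrow> z \<le> max (s n) y \<Longrightarrow> u \<le> v \<Longrightarrow> v < n \<Longrightarrow> z \<in> R v \<Longrightarrow> z = y \<and> v = u"
    using touch[OF t yR] by blast
  have "u \<le> b" using no[of u] u by force
  then show False using e[of z b] bn b sz by auto
qed

section \<open>Death times and the arcs they define\<close>

lemma death:
  assumes "1 \<le> b" "b \<le> m" "y \<in> V b"
  shows death_ge: "b \<le> death m V y b" and death_le: "death m V y b \<le> m"
    and alive_death: "alive V y b (death m V y b)"
    and alive_le_death: "\<And>t. b \<le> t \<Longrightarrow> t \<le> m \<Longrightarrow> alive V y b t \<Longrightarrow> t \<le> death m V y b"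
    and death_s: "death m V y b < m \<Longrightarrow> y = s (death m V y b)"
proof -
  let ?D = "{t. b \<le> t \<and> t \<le> m \<and> alive V y b t}"
  have fin: "finite ?D" by (rule finite_subset[of _ "{..m}"]) auto
  have "b \<in> ?D" using assms by (simp add: alive_def)
  then have in_D: "death m V y b \<in> ?D" unfolding death_def using Max_in[OF fin] by blast
  then show 1: "b \<le> death m V y b" "death m V y b \<le> m" "alive V y b (death m V y b)" by auto
  show 2: "t \<le> death m V y b" if "b \<le> t" "t \<le> m" "alive V y b t" for t
    unfolding death_def using that by (intro Max_ge[OF fin]) auto
  assume lt: "death m V y b < m"
  have "y \<notin> V (Suc (death m V y b))"
  proof
    assume "y \<in> V (Suc (death m V y b))"
    then have "alive V y b (Suc (death m V y b))" using 1 unfolding alive_def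
      by (metis atLeastAtMost_iff le_Suc_eq)
    then show False using 2[of "Suc (death m V y b)"] lt 1 by simp
  qed
  then show "y = s (death m V y b)"
    using leave[OF _ lt] 1 assms unfolding alive_def by auto
qed

lemma death_eq:
  assumes "1 \<le> b" "b \<le> b'" "b' \<le> m" "alive V y b b'"
  shows "death m V y b' = death m V y b"
proof -
  have y: "y \<in> V b" "y \<in> V b'" using assms unfolding alive_def by auto
  have "alive V y b (death m V y b')"
    using assms(4) alive_death[of b' y] assms y unfolding alive_def
    by (metis atLeastAtMost_iff le_trans nle_le)
  then have 1: "death m V y b' \<le> death m V y b"
    using alive_le_death[of b y] death_le[of b' y] death_ge[of b' y] assms y by auto
  have "b' \<le> death m V y b" using alive_le_death[of b y b'] assms y by auto
  moreover have "alive V y b' (death m V y b)"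
    using alive_death[of b y] assms y unfolding alive_def by auto
  ultimately have "death m V y b \<le> death m V y b'"
    using alive_le_death[of b' y] death_le[of b y] assms y by auto
  with 1 show ?thesis by simp
qed

abbreviation "Q \<equiv> left_touched m V R s"

text \<open>By \<open>next_left_touch\<close>, \<open>z\<close> dies before the next touch of
  \<open>y\<close>, hence before \<open>y\<close>. So the death of \<open>z\<close> is an operation
  on \<open>z\<close> and, with \<open>y\<close> still valid to its right, one at the left
  end.\<close>

lemma death_left:
  assumes b: "1 \<le> b" "b \<le> m" and y: "y \<in> Q b" and z: "z \<in> R b" "z < y"
  shows "death m V z b < death m V y b" and "z = s (death m V z b)"
    and "\<forall>v\<in>V (death m V z b). z \<le> v"
    and "next_touch m V R y b n \<Longrightarrow> death m V z b < n"
proof -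
  obtain n where n: "next_touch m V R y b n" "\<forall>v\<in>V n. s n \<le> v" and yR: "y \<in> R b"
    using y unfolding left_touched_def by auto
  have V: "y \<in> V b" "z \<in> V b" using in_V b yR z by auto
  note D = death[OF b V(1)] death[OF b V(2)]
  have nz: "\<not> alive V z b n" using next_left_touch[OF n b(1) yR z] .
  have 1: "death m V z b < n"
  proof (rule ccontr)
    assume "\<not> ?thesis"
    then have "alive V z b n" using D(8) unfolding alive_def by auto
    then show False using nz by simp
  qed
  have 2: "n \<le> death m V y b" using D(4)[of n] n unfolding next_touch_def by auto
  show 3: "death m V z b < death m V y b" using 1 2 by simp
  then show 4: "z = s (death m V z b)" using D(2,10) by simp
  have "y \<in> V (death m V z b)" using D(3,6) 3 unfolding alive_def by auto
  then show "\<forall>v\<in>V (death m V z b). z \<le> v"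
    using extreme[of "death m V z b"] 4 z(2) D(6,7) b by fastforce
  show "death m V z b < n" if "next_touch m V R y b n" for n
  proof -
    have "n = n'" if "next_touch m V R y b n'" for n'
      using that \<open>next_touch m V R y b n\<close> unfolding next_touch_def by (metis nat_neq_iff)
    then show ?thesis using 1 n(1) by auto
  qed
qed

text \<open>
  The largest element of \<open>Q b\<close> is left out, because nothing forces it to die at the left end.
\<close>

definition death_row :: "nat \<Rightarrow> nat set" where
  "death_row b = {death m V z b | z. z \<in> Q b \<and> (\<exists>y\<in>Q b. z < y)}"

lemma left_touched_subset: "y \<in> Q b \<Longrightarrow> y \<in> R b"
  unfolding left_touched_def by simp

text \<open>Let \<open>z\<close>, \<open>y\<close> be the columns of \<open>c\<close>,
  \<open>e\<close> in row \<open>i\<close>, and \<open>x\<close> the column of an offending arc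
  \<open>c'\<close> of row \<open>j\<close>. At time \<open>c\<close> column \<open>z\<close> is
  leftmost, so \<open>z < x\<close>; at time \<open>c'\<close> column \<open>x\<close> is leftmost,
  so \<open>x \<le> y\<close>. If \<open>x < y\<close>, the touch of \<open>x\<close> at
  \<open>j\<close> contradicts \<open>frozen\<close>; if \<open>x = y\<close>, it comes too early,
  because \<open>y\<close> is touched again only after \<open>z\<close> has died.\<close>

lemma death_row_disjoint:
  assumes i: "1 \<le> i" "i < j" "j \<le> m" and ce: "c \<in> death_row i" "e \<in> death_row i" and jc: "j < c"
  shows "death_row j \<inter> {c<..e} = {}"
proof (rule ccontr)
  assume "\<not> ?thesis"
  then obtain c' where c': "c' \<in> death_row j" "c < c'" "c' \<le> e" by auto
  obtain z where z: "z \<in> Q i" "c = death m V z i" using ce unfolding death_row_def by auto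
  obtain y where y: "y \<in> Q i" "e = death m V y i" using ce unfolding death_row_def by auto
  obtain x w where x: "x \<in> Q j" "c' = death m V x j" "w \<in> Q j" "x < w"
    using c' unfolding death_row_def by auto
  have R: "z \<in> R i" "y \<in> R i" "x \<in> R j" using x y z left_touched_subset by auto
  have im: "i \<le> m" "1 \<le> j" using i by auto
  have V: "z \<in> V i" "y \<in> V i" "x \<in> V j" using in_V R i by auto
  note Dz = death[OF i(1) im(1) V(1)] and Dy = death[OF i(1) im(1) V(2)] and Dx = death[OF im(2) i(3) V(3)]
  have zy: "z < y"
    using death_left(1)[OF i(1) im(1) z(1) R(2)] z y c' by (metis leD less_le_trans not_less_iff_gr_or_eq)
  note dz = death_left[OF i(1) im(1) y(1) R(1) zy]
  have al: "alive V z i j" "alive V y i j"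
    using Dz(3) Dy(3) jc c' z y i unfolding alive_def by auto
  have "x \<in> V c" using Dx(3) jc c' x unfolding alive_def by auto
  then have zx: "z \<le> x" using dz(3) z by simp
  \<comment> \<open>Equal columns would share one lifetime, hence one death time.\<close>
  have "x \<noteq> z" using death_eq[of i j z] al i z x c' by auto
  then have zx: "z < x" using zx by simp
  have "y \<in> V c'" using Dy(3) c' jc i y unfolding alive_def by auto
  then have xy: "x \<le> y" using death_left(3)[OF im(2) i(3) x(3) R(3) x(4)] x by simp
  show False
  proof (cases "x = y")
    case True
    obtain n where n: "next_touch m V R y i n" using y unfolding left_touched_def by auto
    then have "c < n" using dz(4) z by simp
    then show False using n True R i jc unfolding next_touch_def by auto
  next
    case False
    then show False using frozen[OF i(1) R(1,2) zx _ i(2,3) al] xy R by simp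
  qed
qed

text \<open>Arcs point beyond their row because the column is touched again before it dies. Index
  and position of a row agree here and separate only under contraction; the limit
  \<open>Suc m\<close> admits a death at \<open>m\<close>.\<close>

lemma sparse_death_rows: "sparse_rows {1..m} (\<lambda>b. b) death_row (Suc m)"
  unfolding sparse_rows_def
proof (intro conjI ballI impI)
  fix b assume b: "b \<in> {1..m}"
  show "death_row b \<subseteq> {b<..<Suc m}"
  proof
    fix c assume "c \<in> death_row b"
    then obtain z where z: "z \<in> Q b" "c = death m V z b" unfolding death_row_def by auto
    then obtain n where n: "next_touch m V R z b n" and zR: "z \<in> R b" unfolding left_touched_def by auto
    have zV: "z \<in> V b" using in_V[OF b zR] .
    have "n \<le> c" using alive_le_death[of b z n] b zV n z unfolding next_touch_def by auto
    moreover have "c \<le> m" using death_le[of b z] b zV z by simp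
    ultimately show "c \<in> {b<..<Suc m}" using n unfolding next_touch_def by auto
  qed
next
  fix i j c e assume "i \<in> {1..m}" "j \<in> {1..m}" "c \<in> death_row i" "e \<in> death_row i" "i < j \<and> j < c"
  then show "death_row j \<inter> {c<..e} = {}" using death_row_disjoint[of i j c e] by auto
qed simp

lemma finite_R: "b \<in> {1..m} \<Longrightarrow> finite (R b)"
  using R_subset finite_V finite_subset by blast

text \<open>By \<open>death_left\<close> the columns of one row die at distinct times, so arcs count
  columns; the 1 is for the largest column.\<close>

lemma card_left_touched:
  assumes b: "b \<in> {1..m}"
  shows "card (Q b) \<le> card (death_row b) + 1"
proof -
  let ?N = "{z \<in> Q b. \<exists>y\<in>Q b. z < y}"
  have fin: "finite (Q b)" using finite_R[OF b] by (rule rev_finite_subset) (auto simp: left_touched_def)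
  have row: "death_row b = (\<lambda>z. death m V z b) ` ?N" unfolding death_row_def by auto
  have mono: "death m V z b < death m V y b" if "z \<in> ?N" "y \<in> ?N" "z < y" for z y
    using death_left(1)[of b y z] left_touched_subset b that by auto
  have "inj_on (\<lambda>z. death m V z b) ?N"
  proof (rule inj_onI)
    fix y z assume "y \<in> ?N" "z \<in> ?N" "death m V y b = death m V z b"
    then show "y = z" using mono[of y z] mono[of z y] by (cases y z rule: linorder_cases) simp_all
  qed
  then have "card (death_row b) = card ?N" unfolding row by (rule card_image)
  moreover have "Q b \<subseteq> insert (Max (Q b)) ?N"
  proof
    fix y assume y: "y \<in> Q b"
    then have "Max (Q b) \<in> Q b" "y \<le> Max (Q b)" using Max_in[OF fin] Max_ge[OF fin y] by blast+
    then have "y = Max (Q b) \<or> (\<exists>x\<in>Q b. y < x)" by (metis order_le_imp_less_or_eq)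
    then show "y \<in> insert (Max (Q b)) ?N" using y by blast
  qed
  then have "card (Q b) \<le> card (insert (Max (Q b)) ?N)" using fin by (intro card_mono) auto
  ultimately show ?thesis using card_insert_le_m1[of "Suc (card ?N)" ?N "Max (Q b)"] by simp
qed

section \<open>Summing all touches of a deque\<close>

lemma sum_left_touched:
  assumes "Suc m \<le> ackermann i k"
  shows "(\<Sum>b\<in>{1..m}. card (Q b)) \<le> (2 * i + 2) * m + (4 * 2 ^ i - 2) * k * Suc m"
proof -
  have "(\<Sum>b\<in>{1..m}. card (Q b)) \<le> (\<Sum>b\<in>{1..m}. card (death_row b) + 1)"
    by (intro sum_mono card_left_touched) auto
  also have "\<dots> = (\<Sum>b\<in>{1..m}. card (death_row b)) + m" by (simp only: sum.distrib) simp
  also have "(\<Sum>b\<in>{1..m}. card (death_row b)) \<le> (2 * i + 1) * card {1..m} + (4 * 2 ^ i - 2) * k * Suc m"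
    using rows_bound_ackermann[of i k] sparse_death_rows assms unfolding rows_bound_def by blast
  finally show ?thesis by (simp only: card_atLeastAtMost) (simp add: algebra_simps)
qed

text \<open>Last touches of the updated column cost 1 per row. Any other column that died before
  \<open>m\<close> would be touched again at its death, as the updated column. So the remaining last
  touches have columns alive up to \<open>m\<close>, at most one for each element of
  \<open>U\<close>.\<close>

lemma last_touches:
  assumes U: "finite U" "\<And>t. t \<in> {1..m} \<Longrightarrow> V t \<subseteq> U"
  shows "(\<Sum>b\<in>{1..m}. card {y \<in> R b. \<nexists>t. next_touch m V R y b t}) \<le> m + card U"
proof -
  let ?W = "\<lambda>b. {y \<in> R b. (\<nexists>t. next_touch m V R y b t) \<and> y \<noteq> s b}"
  have ex: "\<exists>t'. next_touch m V R y b t'" if "b < t" "t \<le> m" "alive V y b t" "y \<in> R t" for y b t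
  proof -
    let ?t = "LEAST t. b < t \<and> y \<in> R t"
    have 1: "b < ?t \<and> y \<in> R ?t" by (rule LeastI[of _ t]) (use that in simp)
    moreover have 2: "?t \<le> t" by (rule Least_le) (use that in simp)
    moreover have "y \<notin> R u" if "b < u" "u < ?t" for u using not_less_Least[OF that(2)] that(1) by auto
    ultimately show ?thesis using that unfolding next_touch_def alive_def
      by (intro exI[of _ ?t]) auto
  qed
  have last: "alive V y b m" if y: "y \<in> ?W b" and b: "b \<in> {1..m}" for y b
  proof -
    have yV: "y \<in> V b" using in_V[OF b] y by simp
    have bb: "1 \<le> b" "b \<le> m" using b by auto
    note D = death[OF bb yV]
    have "death m V y b = m"
    proof (rule ccontr)
      assume "death m V y b \<noteq> m"
      then have lt: "death m V y b < m" using D(2) by simp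
      then have ys: "y = s (death m V y b)" using D(5) by simp
      then have "b < death m V y b" using y D(1) by (cases "b = death m V y b") auto
      moreover have "y \<in> R (death m V y b)" using s_in_R[of "death m V y b"] ys lt D(1) bb by simp
      ultimately show False using ex[of b "death m V y b" y] D y by auto
    qed
    then show ?thesis using D(3) by simp
  qed
  have "(\<Sum>b\<in>{1..m}. card (?W b)) \<le> card U"
  proof (rule sum_card_disjoint_le)
    show "?W b \<subseteq> U" if "b \<in> {1..m}" for b using in_V[OF that] U(2)[OF that] by auto
    show "?W i \<inter> ?W j = {}" if i: "i \<in> {1..m}" and j: "j \<in> {1..m}" and ij: "i < j" for i j
    proof (rule ccontr)
      assume "\<not> ?thesis"
      then obtain y where y: "y \<in> ?W i" "y \<in> R j" by auto
      have "alive V y i j" using last[OF y(1) i] j unfolding alive_def by auto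
      then show False using ex[OF ij] j y by auto
    qed
  qed (use U in auto)
  moreover have "card {y \<in> R b. \<nexists>t. next_touch m V R y b t} \<le> 1 + card (?W b)" if b: "b \<in> {1..m}" for b
  proof -
    have "card {y \<in> R b. \<nexists>t. next_touch m V R y b t} \<le> card (insert (s b) (?W b))"
      using finite_R[OF b] by (intro card_mono) auto
    then show ?thesis using card_insert_le_m1[of "Suc (card (?W b))" "?W b" "s b"] by simp
  qed
  then have "(\<Sum>b\<in>{1..m}. card {y \<in> R b. \<nexists>t. next_touch m V R y b t}) \<le> (\<Sum>b\<in>{1..m}. 1 + card (?W b))"
    by (intro sum_mono) auto
  ultimately show ?thesis by (simp only: sum.distrib) simp
qed

lemma mem_uminus_image: "y \<in> uminus ` A \<longleftrightarrow> - y \<in> A" for y :: int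
  by (auto intro: image_eqI[of y uminus "- y"])

lemma reflected: "deque_touches m (\<lambda>t. uminus ` V t) (\<lambda>t. uminus ` R t) (\<lambda>t. - s t)"
proof
  have al: "alive (\<lambda>t. uminus ` V t) y b t \<longleftrightarrow> alive V (- y) b t" for y b t
    unfolding alive_def mem_uminus_image ..
  fix t y assume t: "t \<in> {1..m}" and y: "y \<in> uminus ` R t" "y \<noteq> - s t"
  then obtain u where u: "1 \<le> u" "u < t" "- y \<in> R u" "alive V (- y) u t"
    and e: "\<forall>z v. min (s t) (- y) \<le> z \<and> z \<le> max (s t) (- y) \<and> u \<le> v \<and> v < t \<and> z \<in> R v \<longrightarrow> z = - y \<and> v = u"
    using touch[OF t, of "- y"] by auto
  have "z = y \<and> v = u" if *: "min (- s t) y \<le> z" "z \<le> max (- s t) y" "u \<le> v" "v < t" "z \<in> uminus ` R v" for z v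
  proof -
    have "- z \<in> R v" using * by auto
    moreover have "min (s t) (- y) \<le> - z" "- z \<le> max (s t) (- y)" using *(1,2) by linarith+
    ultimately have "- z = - y \<and> v = u" using e * by blast
    then show ?thesis by simp
  qed
  moreover have "y \<in> uminus ` R u" using u(3) by (metis image_eqI minus_minus)
  ultimately show "\<exists>u. 1 \<le> u \<and> u < t \<and> y \<in> uminus ` R u \<and> alive (\<lambda>t. uminus ` V t) y u t \<and>
      (\<forall>z v. min (- s t) y \<le> z \<and> z \<le> max (- s t) y \<and> u \<le> v \<and> v < t \<and> z \<in> uminus ` R v
        \<longrightarrow> z = y \<and> v = u)"
    using u al by blast
next
  fix t assume "t \<in> {1..m}"
  then show "(\<forall>v\<in>uminus ` V t. - s t \<le> v) \<or> (\<forall>v\<in>uminus ` V t. v \<le> - s t)"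
    using extreme[of t] by auto
next
  fix t y assume "1 \<le> t" "t < m" "y \<in> uminus ` V t" "y \<notin> uminus ` V (Suc t)"
  then show "y = - s t" using leave[of t "- y"] by force
qed (use finite_V R_subset s_in_R in auto)

lemma sum_touches:
  assumes U: "finite U" "\<And>t. t \<in> {1..m} \<Longrightarrow> V t \<subseteq> U" and A: "Suc m \<le> ackermann i k"
  shows "(\<Sum>b\<in>{1..m}. card (R b)) \<le> 2 * ((2 * i + 2) * m + (4 * 2 ^ i - 2) * k * Suc m) + m + card U"
proof -
  let ?V = "\<lambda>t. uminus ` V t" and ?R = "\<lambda>t. uminus ` R t"
  interpret r: deque_touches m ?V ?R "\<lambda>t. - s t" by (rule reflected)
  let ?N = "\<lambda>b. {y \<in> R b. \<nexists>t. next_touch m V R y b t}"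
  have "card (R b) \<le> card (Q b) + card (r.Q b) + card (?N b)" if b: "b \<in> {1..m}" for b
  proof -
    have fin: "finite (R b)" "finite (?R b)" using finite_R[OF b] by auto
    \<comment> \<open>The next touch is caused at the left end or at the right end; counting a touch
      on both sides does no harm.\<close>
    have "R b \<subseteq> Q b \<union> uminus ` r.Q b \<union> ?N b"
    proof
      fix y assume y: "y \<in> R b"
      show "y \<in> Q b \<union> uminus ` r.Q b \<union> ?N b"
      proof (cases "\<exists>t. next_touch m V R y b t")
        case True
        then obtain t where t: "next_touch m V R y b t" by auto
        have t': "next_touch m ?V ?R (- y) b t"
          using t unfolding next_touch_def alive_def mem_uminus_image minus_minus .
        have "t \<in> {1..m}" using t b unfolding next_touch_def by auto
        from extreme[OF this] show ?thesis
        proof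
          assume "\<forall>v\<in>V t. s t \<le> v"
          then show ?thesis using t y unfolding left_touched_def by auto
        next
          assume "\<forall>v\<in>V t. v \<le> s t"
          then have "- y \<in> r.Q b" using t' y unfolding left_touched_def by auto
          then show ?thesis unfolding Un_iff mem_uminus_image by blast
        qed
      qed (use y in auto)
    qed
    moreover have "finite (Q b)" "finite (r.Q b)"
      using fin by (auto simp: left_touched_def)
    ultimately have "card (R b) \<le> card (Q b \<union> uminus ` r.Q b \<union> ?N b)"
      using fin by (intro card_mono) auto
    also have "\<dots> \<le> card (Q b) + card (uminus ` r.Q b) + card (?N b)"
      by (meson card_Un_le add_le_mono1 le_trans)
    also have "card (uminus ` r.Q b) = card (r.Q b)" by (simp add: card_image)
    finally show ?thesis .
  qed
  then have "(\<Sum>b\<in>{1..m}. card (R b)) \<le> (\<Sum>b\<in>{1..m}. card (Q b) + card (r.Q b) + card (?N b))"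
    by (intro sum_mono) auto
  also have "\<dots> \<le> ((2 * i + 2) * m + (4 * 2 ^ i - 2) * k * Suc m)
      + ((2 * i + 2) * m + (4 * 2 ^ i - 2) * k * Suc m) + (m + card U)"
    unfolding sum.distrib
    by (intro add_mono sum_left_touched[OF A] r.sum_left_touched[OF A] last_touches U)
  finally show ?thesis by (simp only: mult_2 add.assoc)
qed

end

section \<open>Validity and greedy rows for deque sequences\<close>

text \<open>Quantifiers replace the \<open>Max\<close> of \<open>prev_upd\<close>, and the formula
  is vacuous without an earlier operation on \<open>x\<close>. It ranges over all operations, since
  a deque sequence has no accesses.\<close>

definition before :: "update_seq \<Rightarrow> operation \<Rightarrow> nat \<Rightarrow> nat \<Rightarrow> bool" where
  "before S oper x t \<longleftrightarrow> (\<forall>t'. 1 \<le> t' \<and> t' < t \<and> elem_at S t' = x \<and>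
     (\<forall>u. t' < u \<and> u < t \<longrightarrow> elem_at S u \<noteq> x) \<longrightarrow> op_at S t' = oper)"

definition after :: "update_seq \<Rightarrow> operation \<Rightarrow> nat \<Rightarrow> nat \<Rightarrow> bool" where
  "after S oper x t \<longleftrightarrow> (\<forall>t'. t < t' \<and> t' \<le> length S \<and> elem_at S t' = x \<and>
     (\<forall>u. t < u \<and> u < t' \<longrightarrow> elem_at S u \<noteq> x) \<longrightarrow> op_at S t' = oper)"

text \<open>Cut \<open>S\<close> at the two list positions, which are the times minus 1. Nothing
  between them concerns \<open>x\<close>, so the filter makes the two updates adjacent.\<close>

lemma updates_alternate:
  assumes S: "update_sequence n S" and t: "1 \<le> t1" "t1 < t2" "t2 \<le> length S"
    and x: "elem_at S t1 = x" "elem_at S t2 = x" "op_at S t1 \<noteq> Access" "op_at S t2 \<noteq> Access"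
    and mid: "\<And>t. t1 < t \<Longrightarrow> t < t2 \<Longrightarrow> elem_at S t \<noteq> x"
  shows "op_at S t1 \<noteq> op_at S t2"
proof -
  define i where "i = t1 - 1"
  define j where "j = t2 - 1"
  have ij: "i < j" "j < length S" using t unfolding i_def j_def by auto
  let ?f = "filter (\<lambda>(y, oper). y = x \<and> oper \<noteq> Access)"
  let ?M = "take (j - Suc i) (drop (Suc i) S)"
  have "S = take i S @ S ! i # drop (Suc i) S" using ij by (intro id_take_nth_drop) auto
  moreover have "drop (Suc i) S = ?M @ S ! j # drop (Suc j) S"
    using id_take_nth_drop[of "j - Suc i" "drop (Suc i) S"] ij by simp
  ultimately have dec: "S = take i S @ S ! i # ?M @ S ! j # drop (Suc j) S" by simp
  have "?f ?M = []"
  proof (rule filter_False, rule ballI)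
    fix a assume "a \<in> set ?M"
    then obtain k where k: "k < length ?M" "a = ?M ! k" by (metis in_set_conv_nth)
    then have "a = S ! (Suc i + k)" "Suc i + k < j" using ij by auto
    then have "fst a \<noteq> x" using mid[of "Suc (Suc i + k)"] t unfolding i_def j_def elem_at_def by simp
    then show "\<not> (case a of (y, oper) \<Rightarrow> y = x \<and> oper \<noteq> Access)" by (auto simp: case_prod_beta)
  qed
  moreover have "?f [S ! i] = [S ! i]" "?f [S ! j] = [S ! j]"
    using x unfolding i_def j_def elem_at_def op_at_def by (auto simp: case_prod_beta)
  ultimately have f: "?f S = ?f (take i S) @ S ! i # S ! j # ?f (drop (Suc j) S)"
    by (subst dec) (simp split: if_splits)
  have "S ! i \<in> set S" using ij by simp
  then have "x \<in> {1..n}" using S x(1) unfolding update_sequence_def i_def elem_at_def by force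
  then have "distinct_adj (map snd (?f S))" using S unfolding update_sequence_def by blast
  then have "snd (S ! i) \<noteq> snd (S ! j)" unfolding f by (simp add: distinct_adj_append_iff)
  then show ?thesis unfolding op_at_def i_def j_def .
qed

lemma map_of_first:
  "map_of S x = Some oper \<Longrightarrow> \<exists>j<length S. S ! j = (x, oper) \<and> (\<forall>i<j. fst (S ! i) \<noteq> x)"
proof (induction S)
  case (Cons a S)
  show ?case
  proof (cases "fst a = x")
    case True
    then show ?thesis using Cons.prems by (intro exI[of _ 0]) (auto simp: prod_eq_iff)
  next
    case False
    then have "map_of S x = Some oper" using Cons.prems by (auto split: if_splits)
    then obtain j where j: "j < length S" "S ! j = (x, oper)" "\<forall>i<j. fst (S ! i) \<noteq> x"
      using Cons.IH by blast
    then show ?thesis using False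
      by (intro exI[of _ "Suc j"]) (auto simp: nth_Cons split: nat.splits)
  qed
qed simp

lemma finite_keys: "finite (keys n S t)"
  by (induction t) (auto split: operation.splits)

section \<open>Validity and extremality in a deque sequence\<close>

locale deque =
  fixes n :: nat and S :: update_seq
  assumes deque: "deque_sequence n S"
begin

lemma update_sequence: "update_sequence n S"
  using deque unfolding deque_sequence_def by simp

lemma not_access: "1 \<le> t \<Longrightarrow> t \<le> length S \<Longrightarrow> op_at S t \<noteq> Access"
  using deque unfolding deque_sequence_def by simp

lemma upd_points_iff: "(x, t) \<in> upd_points S \<longleftrightarrow> 1 \<le> t \<and> t \<le> length S \<and> elem_at S t = x"
  using not_access[of t] unfolding upd_points_def op_points_def by (cases "op_at S t") auto

lemma op_points_iff:
  "(x, t) \<in> op_points oper S \<longleftrightarrow> 1 \<le> t \<and> t \<le> length S \<and> elem_at S t = x \<and> op_at S t = oper"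
  unfolding op_points_def by auto

lemma prev_upd_iff:
  assumes "t \<le> length S"
  shows "set_option (prev_upd S (x, t)) \<subseteq> op_points oper S \<longleftrightarrow> before S oper x t"
proof -
  let ?T = "{u. u < t \<and> (x, u) \<in> upd_points S}"
  have T: "?T = {u. 1 \<le> u \<and> u < t \<and> elem_at S u = x}" using assms by (auto simp: upd_points_iff)
  show ?thesis
  proof (cases "?T = {}")
    case True
    then show ?thesis unfolding prev_upd_def before_def using T by auto
  next
    case False
    have fin: "finite ?T" by simp
    have M: "Max ?T \<in> ?T" using Max_in[OF fin False] .
    have "before S oper x t \<longleftrightarrow> op_at S (Max ?T) = oper"
    proof
      assume b: "before S oper x t"
      have "\<forall>u. Max ?T < u \<and> u < t \<longrightarrow> elem_at S u \<noteq> x"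
      proof (intro allI impI notI)
        fix u assume u: "Max ?T < u \<and> u < t" "elem_at S u = x"
        then have "u \<in> ?T" unfolding T by simp
        then show False using Max_ge[OF fin] u by fastforce
      qed
      then show "op_at S (Max ?T) = oper" using b M T unfolding before_def by blast
    next
      assume o: "op_at S (Max ?T) = oper"
      show "before S oper x t" unfolding before_def
      proof (intro allI impI)
        fix t' assume t': "1 \<le> t' \<and> t' < t \<and> elem_at S t' = x \<and> (\<forall>u. t' < u \<and> u < t \<longrightarrow> elem_at S u \<noteq> x)"
        then have "t' \<in> ?T" unfolding T by simp
        then have "t' \<le> Max ?T" using Max_ge[OF fin] by blast
        moreover have "\<not> t' < Max ?T" using t' M T by auto
        ultimately show "op_at S t' = oper" using o by simp
      qed
    qed
    moreover have "prev_upd S (x, t) = Some (x, Max ?T)"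
      unfolding prev_upd_def using False by (simp add: Let_def)
    moreover have "1 \<le> Max ?T \<and> Max ?T \<le> length S \<and> elem_at S (Max ?T) = x" using M T assms by auto
    ultimately show ?thesis by (simp add: op_points_iff)
  qed
qed

lemma next_upd_iff:
  shows "set_option (next_upd S (x, t)) \<subseteq> op_points oper S \<longleftrightarrow> after S oper x t"
proof -
  let ?T = "{u. u > t \<and> (x, u) \<in> upd_points S}"
  have T: "?T = {u. t < u \<and> u \<le> length S \<and> elem_at S u = x}" by (auto simp: upd_points_iff)
  show ?thesis
  proof (cases "?T = {}")
    case True
    then show ?thesis unfolding next_upd_def after_def using T by auto
  next
    case False
    have fin: "finite ?T" unfolding T by (rule finite_subset[of _ "{..length S}"]) auto
    have M: "Min ?T \<in> ?T" using Min_in[OF fin False] .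
    have "after S oper x t \<longleftrightarrow> op_at S (Min ?T) = oper"
    proof
      assume b: "after S oper x t"
      have "\<forall>u. t < u \<and> u < Min ?T \<longrightarrow> elem_at S u \<noteq> x"
      proof (intro allI impI notI)
        fix u assume u: "t < u \<and> u < Min ?T" "elem_at S u = x"
        then have "u \<in> ?T" using M unfolding T by simp
        then show False using Min_le[OF fin] u by fastforce
      qed
      then show "op_at S (Min ?T) = oper" using b M T unfolding after_def by blast
    next
      assume o: "op_at S (Min ?T) = oper"
      show "after S oper x t" unfolding after_def
      proof (intro allI impI)
        fix t' assume t': "t < t' \<and> t' \<le> length S \<and> elem_at S t' = x \<and> (\<forall>u. t < u \<and> u < t' \<longrightarrow> elem_at S u \<noteq> x)"
        then have "t' \<in> ?T" unfolding T by simp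
        then have "Min ?T \<le> t'" using Min_le[OF fin] by blast
        moreover have "\<not> Min ?T < t'" using t' M T by auto
        ultimately show "op_at S t' = oper" using o by simp
      qed
    qed
    moreover have "next_upd S (x, t) = Some (x, Min ?T)"
      unfolding next_upd_def using False by (simp add: Let_def)
    moreover have "1 \<le> Min ?T \<and> Min ?T \<le> length S \<and> elem_at S (Min ?T) = x" using M T by auto
    ultimately show ?thesis by (simp add: op_points_iff)
  qed
qed

lemma valid_iff:
  "valid n S (x, t) \<longleftrightarrow> x \<in> {1..n} \<and> 1 \<le> t \<and> t \<le> length S \<and>
     (if elem_at S t \<noteq> x then before S Insert x t \<and> after S Delete x t
      else if op_at S t = Insert then before S Delete x t \<and> after S Delete x t
      else before S Insert x t \<and> after S Insert x t)"
proof (cases "1 \<le> t \<and> t \<le> length S")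
  case True
  then have "op_at S t = Insert \<or> op_at S t = Delete" using not_access[of t] by (cases "op_at S t") auto
  then show ?thesis unfolding valid_def
    using True by (auto simp: prev_upd_iff next_upd_iff op_points_iff upd_points_iff)
qed (auto simp: valid_def)

lemma updates_differ:
  assumes "1 \<le> t1" "t1 < t2" "t2 \<le> length S" "elem_at S t1 = elem_at S t2"
    and "\<And>t. t1 < t \<Longrightarrow> t < t2 \<Longrightarrow> elem_at S t \<noteq> elem_at S t2"
  shows "op_at S t1 = Insert \<longleftrightarrow> op_at S t2 = Delete"
proof -
  have "op_at S t1 \<noteq> op_at S t2"
    using updates_alternate[OF update_sequence assms(1-4) refl] not_access assms by simp
  moreover have "op_at S t1 \<noteq> Access" "op_at S t2 \<noteq> Access" using not_access assms by auto
  ultimately show ?thesis by (cases "op_at S t1"; cases "op_at S t2") auto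
qed

lemma before_update:
  assumes "1 \<le> t" "t \<le> length S"
  shows "before S (if op_at S t = Insert then Delete else Insert) (elem_at S t) t"
  unfolding before_def
proof (intro allI impI)
  fix t' assume t': "1 \<le> t' \<and> t' < t \<and> elem_at S t' = elem_at S t \<and>
    (\<forall>u. t' < u \<and> u < t \<longrightarrow> elem_at S u \<noteq> elem_at S t)"
  then have "op_at S t' = Insert \<longleftrightarrow> op_at S t = Delete" using updates_differ[of t' t] assms by auto
  moreover have "op_at S t' \<noteq> Access" "op_at S t \<noteq> Access" using not_access assms t' by auto
  ultimately show "op_at S t' = (if op_at S t = Insert then Delete else Insert)"
    by (cases "op_at S t'"; cases "op_at S t") auto
qed

lemma after_update:
  assumes "1 \<le> t" "t \<le> length S"
  shows "after S (if op_at S t = Insert then Delete else Insert) (elem_at S t) t"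
  unfolding after_def
proof (intro allI impI)
  fix t' assume t': "t < t' \<and> t' \<le> length S \<and> elem_at S t' = elem_at S t \<and>
    (\<forall>u. t < u \<and> u < t' \<longrightarrow> elem_at S u \<noteq> elem_at S t)"
  then have "op_at S t = Insert \<longleftrightarrow> op_at S t' = Delete" using updates_differ[of t t'] assms by auto
  moreover have "op_at S t' \<noteq> Access" "op_at S t \<noteq> Access" using not_access assms t' by auto
  ultimately show "op_at S t' = (if op_at S t = Insert then Delete else Insert)"
    by (cases "op_at S t'"; cases "op_at S t") auto
qed

lemma valid_update:
  assumes "1 \<le> t" "t \<le> length S"
  shows "valid n S (elem_at S t, t)"
proof -
  have "S ! (t - 1) \<in> set S" using assms by simp
  then have "elem_at S t \<in> {1..n}"
    using update_sequence unfolding update_sequence_def elem_at_def by (metis imageI)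
  then show ?thesis using before_update[OF assms] after_update[OF assms] assms
    by (auto simp: valid_iff)
qed

text \<open>The neighbouring updates of such a column are the same at \<open>Suc t\<close>, unless
  \<open>Suc t\<close> itself updates it, and update points are always valid. This supplies the
  assumption \<open>leave\<close> of \<open>deque_touches\<close>.\<close>

lemma valid_Suc:
  assumes v: "valid n S (x, t)" and t: "t < length S" and x: "elem_at S t \<noteq> x"
  shows "valid n S (x, Suc t)"
proof (cases "elem_at S (Suc t) = x")
  case True
  then show ?thesis using valid_update[of "Suc t"] t by simp
next
  case False
  have b: "before S Insert x t" and a: "after S Delete x t" and n: "x \<in> {1..n}"
    using v x by (auto simp: valid_iff)
  have "before S Insert x (Suc t)"
    using b x unfolding before_def by (metis less_Suc_eq)
  moreover have "after S Delete x (Suc t)"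
    using a False unfolding after_def by (metis Suc_lessD Suc_lessI)
  ultimately show ?thesis using n False t by (auto simp: valid_iff)
qed

text \<open>\<open>before\<close> at \<open>Suc t\<close> covers the operations up to
  \<open>t\<close>; the condition on \<open>map_of\<close> settles columns without such an
  operation, whose membership is inherited from the initial key set.\<close>

lemma in_keys:
  assumes "x \<in> {1..n}"
  shows "t \<le> length S \<Longrightarrow> before S Insert x (Suc t) \<Longrightarrow>
    (\<forall>u. 1 \<le> u \<and> u \<le> t \<longrightarrow> elem_at S u \<noteq> x) \<longrightarrow> map_of S x \<noteq> Some Insert \<Longrightarrow> x \<in> keys n S t"
proof (induction t)
  case (Suc t)
  show ?case
  proof (cases "elem_at S (Suc t) = x")
    case True
    then have "op_at S (Suc t) = Insert" using Suc.prems(2) unfolding before_def by auto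
    then show ?thesis using True by simp
  next
    case False
    have "before S Insert x (Suc t)"
      using Suc.prems(2) False unfolding before_def by (metis less_SucE less_SucI)
    then have "x \<in> keys n S t" using Suc False by (metis Suc_leD le_Suc_eq)
    then show ?thesis using False by (auto split: operation.splits)
  qed
qed (use assms in auto)

text \<open>Both key sets occur because the deque condition refers to the set after an insertion but
  before a deletion.\<close>

lemma valid_in_keys:
  assumes v: "valid n S (x, t)" and x: "elem_at S t \<noteq> x"
  shows "x \<in> keys n S t \<and> x \<in> keys n S (t - 1)"
proof -
  have b: "before S Insert x t" and a: "after S Delete x t" and n: "x \<in> {1..n}" "1 \<le> t" "t \<le> length S"
    using v x by (auto simp: valid_iff)
  \<comment> \<open>If the first operation on \<open>x\<close> were an insertion, it would come
    after \<open>t\<close>, against \<open>after S Delete x t\<close>.\<close>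
  have first: "map_of S x \<noteq> Some Insert" if no: "\<And>u. 1 \<le> u \<Longrightarrow> u < t \<Longrightarrow> elem_at S u \<noteq> x"
  proof
    assume "map_of S x = Some Insert"
    from map_of_first[OF this] obtain j
      where j: "j < length S" "S ! j = (x, Insert)" "\<forall>i<j. fst (S ! i) \<noteq> x" by blast
    have e: "elem_at S (Suc j) = x" "op_at S (Suc j) = Insert" using j unfolding elem_at_def op_at_def by auto
    then have "t < Suc j" using no[of "Suc j"] x by (cases t "Suc j" rule: linorder_cases) auto
    moreover have "\<forall>u. t < u \<and> u < Suc j \<longrightarrow> elem_at S u \<noteq> x"
    proof (intro allI impI)
      fix u assume "t < u \<and> u < Suc j"
      then have "u - 1 < j" by linarith
      then show "elem_at S u \<noteq> x" using j(3) unfolding elem_at_def by blast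
    qed
    ultimately have "op_at S (Suc j) = Delete" using a e j(1) unfolding after_def by auto
    then show False using e by simp
  qed
  have "before S Insert x (Suc t)" using b x unfolding before_def by (metis less_Suc_eq)
  then have "x \<in> keys n S t" using in_keys[OF n(1) n(3)] first by simp
  moreover have "before S Insert x (Suc (t - 1))" using b n by simp
  then have "x \<in> keys n S (t - 1)" using in_keys[OF n(1), of "t - 1"] n first by auto
  ultimately show ?thesis ..
qed

text \<open>The updated element is extreme in a key set, and \<open>valid_in_keys\<close> puts every
  other valid column into that set.\<close>

lemma update_extreme:
  assumes t: "1 \<le> t" "t \<le> length S"
  shows "(\<forall>x. valid n S (x, t) \<longrightarrow> elem_at S t \<le> x) \<or> (\<forall>x. valid n S (x, t) \<longrightarrow> x \<le> elem_at S t)"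
proof -
  obtain t' where t': "t' = t \<or> t' = t - 1"
    "elem_at S t = Min (keys n S t') \<or> elem_at S t = Max (keys n S t')"
  proof -
    have "op_at S t \<noteq> Access"
      "op_at S t = Insert \<Longrightarrow> elem_at S t = Min (keys n S t) \<or> elem_at S t = Max (keys n S t)"
      "op_at S t = Delete \<Longrightarrow> elem_at S t = Min (keys n S (t - 1)) \<or> elem_at S t = Max (keys n S (t - 1))"
      using deque t unfolding deque_sequence_def by simp_all
    then show ?thesis using that by (cases "op_at S t") blast+
  qed
  have "x = elem_at S t \<or> x \<in> keys n S t'" if "valid n S (x, t)" for x
    using valid_in_keys[OF that] t' by auto
  then show ?thesis using t'(2) finite_keys[of n S t'] by (metis Max_ge Min_le order_refl)
qed

section \<open>Greedy as an instance of deque touches\<close>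

lemma greedy_rows_deque:
  assumes t: "1 \<le> t" "t \<le> length S"
  shows "greedy_rows n S t P = {project t (stair n S P (elem_at S t, t))}"
proof -
  \<comment> \<open>An extreme element has no valid column on one side, so the choice between two
    stairs never arises.\<close>
  have "pred_point n S (elem_at S t, t) = None \<or> succ_point n S (elem_at S t, t) = None"
    using update_extreme[OF t] unfolding pred_point_def succ_point_def Let_def
    by (auto simp: not_le[symmetric])
  then show ?thesis unfolding greedy_rows_def Let_def by (auto split: option.splits)
qed

text \<open>Rows added later leave the points before row \<open>u\<close> unchanged, so each row can
  be described from the final \<open>P\<close> alone.\<close>

lemma greedy_upto_rows:
  assumes "greedy_upto n S t P"
  shows "snd ` P \<subseteq> {1..t} \<and> (\<forall>u\<in>{1..t}. \<forall>x. (x, u) \<in> P \<longleftrightarrow>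
     x \<in> fst ` stair n S {q \<in> P. snd q < u} (elem_at S u, u))"
  using assms
proof induction
  case start
  then show ?case by simp
next
  case (row t P R)
  have R: "R = project (Suc t) (stair n S P (elem_at S (Suc t), Suc t))"
    using row greedy_rows_deque[of "Suc t" P] by simp
  have P: "snd ` P \<subseteq> {1..t}" using row by simp
  have less: "{q \<in> P \<union> R. snd q < u} = {q \<in> P. snd q < u}" if "u \<le> Suc t" for u
    using that unfolding R project_def by auto
  have all: "{q \<in> P. snd q < Suc t} = P" using P by force
  show ?case
  proof (intro conjI ballI allI)
    show "snd ` (P \<union> R) \<subseteq> {1..Suc t}" using P unfolding R project_def by auto
    fix u x assume u: "u \<in> {1..Suc t}"
    show "(x, u) \<in> P \<union> R \<longleftrightarrow> x \<in> fst ` stair n S {q \<in> P \<union> R. snd q < u} (elem_at S u, u)"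
    proof (cases "u = Suc t")
      case True
      have "(x, u) \<notin> P" using P True by force
      then show ?thesis using less[of u] all True unfolding R project_def by (auto simp: image_iff)
    next
      case False
      have "(x, u) \<notin> R" using False unfolding R project_def by auto
      moreover have "(x, u) \<in> P \<longleftrightarrow> x \<in> fst ` stair n S {q \<in> P. snd q < u} (elem_at S u, u)"
        using row False u by auto
      ultimately show ?thesis using less[of u] u by simp
    qed
  qed
qed

lemma active_time_valid: "v \<in> active_time n S (x, u) \<Longrightarrow> valid n S (x, v)"
  unfolding active_time_def by auto

lemma greedy_touches:
  assumes G: "greedy n S P"
  shows "deque_touches (length S) (\<lambda>t. int ` {x. valid n S (x, t)}) (\<lambda>t. int ` {x. (x, t) \<in> P})
    (\<lambda>t. int (elem_at S t))"
proof -
  have rows: "snd ` P \<subseteq> {1..length S}" "\<And>u x. u \<in> {1..length S} \<Longrightarrow> (x, u) \<in> P \<longleftrightarrow>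
     x \<in> fst ` stair n S {q \<in> P. snd q < u} (elem_at S u, u)"
    using greedy_upto_rows[OF G[unfolded greedy_def]] by auto
  \<comment> \<open>A touched column other than the updated one comes from a stair point
    \<open>(x, u)\<close>: the active pair keeps \<open>x\<close> valid from \<open>u\<close> to
    \<open>t\<close>, and the rectangle condition leaves no other point.\<close>
  have touch: "\<exists>u. 1 \<le> u \<and> u < t \<and> (x, u) \<in> P \<and> (\<forall>v. u \<le> v \<and> v \<le> t \<longrightarrow> valid n S (x, v)) \<and>
      (\<forall>z v. min (elem_at S t) x \<le> z \<and> z \<le> max (elem_at S t) x \<and> u \<le> v \<and> v < t \<and> (z, v) \<in> P
        \<longrightarrow> z = x \<and> v = u)" if t: "t \<in> {1..length S}" and x: "(x, t) \<in> P" "x \<noteq> elem_at S t" for t x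
  proof -
    let ?P = "{q \<in> P. snd q < t}" and ?p = "(elem_at S t, t)"
    obtain q where q: "q \<in> stair n S ?P ?p" "x = fst q" using rows(2)[OF t] x(1) by blast
    then have "q \<noteq> ?p" using x(2) by auto
    then obtain u where u: "q = (x, u)" "u < t" "(x, u) \<in> P" "active_pair n S ?p (x, u)"
      "rect ?p (x, u) \<inter> ?P = {(x, u)}"
      using q unfolding stair_def by (cases q) auto
    have "valid n S (x, v)" if "u \<le> v" "v \<le> t" for v
    proof -
      have "v \<in> active_time n S (x, u)" using u(2,4) that unfolding active_pair_def by auto
      then show ?thesis by (rule active_time_valid)
    qed
    moreover have "z = x \<and> v = u"
      if "min (elem_at S t) x \<le> z" "z \<le> max (elem_at S t) x" "u \<le> v" "v < t" "(z, v) \<in> P" for z v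
    proof -
      have "(z, v) \<in> rect ?p (x, u) \<inter> ?P" using that unfolding rect_def by auto
      then show ?thesis using u(5) by auto
    qed
    moreover have "1 \<le> u" using u(3) rows(1) by force
    ultimately show ?thesis using u(2,3) by blast
  qed
  show ?thesis
  proof
    fix t assume t: "t \<in> {1..length S}"
    show "finite (int ` {x. valid n S (x, t)})"
      by (rule finite_imageI, rule finite_subset[of _ "{1..n}"]) (auto simp: valid_def)
    show "int ` {x. (x, t) \<in> P} \<subseteq> int ` {x. valid n S (x, t)}"
    proof (rule image_mono, rule subsetI)
      fix x assume "x \<in> {x. (x, t) \<in> P}"
      then show "x \<in> {x. valid n S (x, t)}"
        using touch[OF t, of x] valid_update[of t] t by (cases "x = elem_at S t") auto
    qed
    show "int (elem_at S t) \<in> int ` {x. (x, t) \<in> P}"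
      using rows(2)[OF t, of "elem_at S t"] unfolding stair_def by (auto simp: image_iff)
    show "(\<forall>v\<in>int ` {x. valid n S (x, t)}. int (elem_at S t) \<le> v) \<or>
        (\<forall>v\<in>int ` {x. valid n S (x, t)}. v \<le> int (elem_at S t))"
      using update_extreme[of t] t by auto
  next
    fix t y assume "1 \<le> t" "t < length S" "y \<in> int ` {x. valid n S (x, t)}"
      "y \<notin> int ` {x. valid n S (x, Suc t)}"
    then show "y = int (elem_at S t)" using valid_Suc by blast
  next
    fix t y assume t: "t \<in> {1..length S}" and y: "y \<in> int ` {x. (x, t) \<in> P}" "y \<noteq> int (elem_at S t)"
    then obtain x where x: "y = int x" "(x, t) \<in> P" "x \<noteq> elem_at S t" by auto
    from touch[OF t x(2,3)] obtain u where u: "1 \<le> u" "u < t" "(x, u) \<in> P"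
      "\<And>v. u \<le> v \<Longrightarrow> v \<le> t \<Longrightarrow> valid n S (x, v)" and e: "\<And>z v. min (elem_at S t) x \<le> z \<Longrightarrow>
        z \<le> max (elem_at S t) x \<Longrightarrow> u \<le> v \<Longrightarrow> v < t \<Longrightarrow> (z, v) \<in> P \<Longrightarrow> z = x \<and> v = u" by blast
    have "z = y \<and> v = u" if *: "min (int (elem_at S t)) y \<le> z" "z \<le> max (int (elem_at S t)) y"
      "u \<le> v" "v < t" "z \<in> int ` {x. (x, v) \<in> P}" for z v
    proof -
      obtain w where w: "z = int w" "(w, v) \<in> P" using *(5) by auto
      have "min (elem_at S t) x \<le> w" "w \<le> max (elem_at S t) x" using *(1,2) w x(1) by linarith+
      then show ?thesis using e[of w v] w x(1) *(3,4) by simp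
    qed
    then show "\<exists>u. 1 \<le> u \<and> u < t \<and> y \<in> int ` {x. (x, u) \<in> P} \<and>
        alive (\<lambda>t. int ` {x. valid n S (x, t)}) y u t \<and>
        (\<forall>z v. min (int (elem_at S t)) y \<le> z \<and> z \<le> max (int (elem_at S t)) y \<and> u \<le> v \<and> v < t \<and>
          z \<in> int ` {x. (x, v) \<in> P} \<longrightarrow> z = y \<and> v = u)"
      using u x(1) unfolding alive_def by (intro exI[of _ u]) auto
  qed
qed

lemma card_greedy:
  assumes G: "greedy n S P" and A: "Suc (length S) \<le> ackermann i k"
  shows "card P \<le> 2 * ((2 * i + 2) * length S + (4 * 2 ^ i - 2) * k * Suc (length S)) + length S + n"
proof -
  interpret T: deque_touches "length S" "\<lambda>t. int ` {x. valid n S (x, t)}" "\<lambda>t. int ` {x. (x, t) \<in> P}"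
    "\<lambda>t. int (elem_at S t)" by (rule greedy_touches[OF G])
  have fin: "finite {x. (x, t) \<in> P}" if "t \<in> {1..length S}" for t
    using T.finite_R[OF that] by (rule finite_imageD) simp
  have "snd ` P \<subseteq> {1..length S}" using greedy_upto_rows[OF G[unfolded greedy_def]] by auto
  then have "P \<subseteq> prod.swap ` Sigma {1..length S} (\<lambda>t. {x. (x, t) \<in> P})"
    by (force simp: image_iff)
  then have "card P \<le> card (prod.swap ` Sigma {1..length S} (\<lambda>t. {x. (x, t) \<in> P}))"
    using fin by (intro card_mono finite_imageI finite_SigmaI) auto
  also have "\<dots> \<le> card (Sigma {1..length S} (\<lambda>t. {x. (x, t) \<in> P}))"
    using fin by (intro card_image_le finite_SigmaI) auto
  also have "\<dots> = (\<Sum>t\<in>{1..length S}. card (int ` {x. (x, t) \<in> P}))"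
    using fin by (simp add: card_image)
  also have "\<dots> \<le> 2 * ((2 * i + 2) * length S + (4 * 2 ^ i - 2) * k * Suc (length S)) + length S
      + card (int ` {1..n})"
    by (rule T.sum_touches[OF _ _ A]) (auto simp: valid_def)
  finally show ?thesis by (simp add: card_image)
qed

end

section \<open>The inverse Ackermann function\<close>

lemma ackermann_1: "ackermann 1 (Suc x) = 2 ^ Suc x"
  by (induction x) (auto simp: numeral_eq_Suc)

lemma ackermann_mono_left: "i \<le> j \<Longrightarrow> ackermann i x \<le> ackermann j x"
  by (rule lift_Suc_mono_le[of "\<lambda>i. ackermann i x"]) (rule ackermann_Suc_ge)

text \<open>Shows that the minimum in \<open>inv_ackermann\<close> exists for column 4. Every row
  has value 4 at 2, so \<open>ackermann (Suc z) 3 = ackermann z 4\<close>, and one more unfolding at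
  least doubles this value.\<close>

lemma ackermann_four: "z < ackermann z 4"
proof (induction z)
  case (Suc z)
  have 3: "ackermann (Suc z) 3 = ackermann z 4"
  proof -
    have "ackermann z 2 = 4" for z by (induction z) (simp_all add: numeral_eq_Suc)
    then show ?thesis by (simp add: numeral_eq_Suc)
  qed
  have "2 * ackermann z 4 \<le> ackermann z (ackermann (Suc z) 3)"
    unfolding 3 by (rule ackermann_ge)
  also have "\<dots> = ackermann (Suc z) 4" by (simp add: numeral_eq_Suc)
  finally show ?case using Suc by simp
qed simp

text \<open>The column is 4 because \<open>m / (n + m)\<close> rounds up to 1. Undoing the logarithm
  costs one exponential, which is row 1 of the Ackermann function and is absorbed by passing to row
  \<open>Suc ?z\<close> and column 5.\<close>

lemma less_ackermann_inv:
  assumes "1 \<le> m"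
  shows "n + m < ackermann (Suc (inv_ackermann m (n + m))) 5"
proof -
  let ?z = "inv_ackermann m (n + m)" and ?N = "n + m"
  have "\<lceil>real m / real ?N\<rceil> = 1"
    using assms by (intro ceiling_unique) (auto simp: divide_simps)
  then have inv: "?z = (LEAST z. z \<ge> 1 \<and> real (ackermann z 4) > log 2 (real ?N))"
    unfolding inv_ackermann_def by simp
  have log: "log 2 (real N) < real k \<longleftrightarrow> N < 2 ^ k" if "N > 0" for N k :: nat
  proof -
    have "log 2 (real N) < real k \<longleftrightarrow> real N < 2 ^ k"
      using that by (simp add: log_less_iff powr_realpow)
    also have "\<dots> \<longleftrightarrow> N < 2 ^ k" by (metis of_nat_less_iff of_nat_numeral of_nat_power)
    finally show ?thesis .
  qed
  have "log 2 (real ?N) < real ?N" using log[of ?N ?N] assms less_exp[of ?N] by simp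
  then have "?N \<ge> 1 \<and> real (ackermann ?N 4) > log 2 (real ?N)"
    using ackermann_four[of ?N] assms by linarith
  then have z: "?z \<ge> 1 \<and> real (ackermann ?z 4) > log 2 (real ?N)"
    unfolding inv by (rule LeastI)
  then have "?N < 2 ^ ackermann ?z 4" using log[of ?N "ackermann ?z 4"] assms by simp
  also have "\<dots> = ackermann 1 (ackermann ?z 4)"
    using ackermann_1[of "ackermann ?z 4 - 1"] ackermann_four[of ?z] by simp
  also have "\<dots> \<le> ackermann ?z (ackermann ?z 4)" using z by (intro ackermann_mono_left) simp
  also have "\<dots> \<le> ackermann ?z (ackermann (Suc ?z) 4)" by (intro ackermann_mono ackermann_Suc_ge)
  also have "\<dots> = ackermann (Suc ?z) 5" by (simp add: numeral_eq_Suc)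
  finally show ?thesis .
qed

theorem theorem24:
  "\<exists>C::real. C > 0 \<and>
     (\<forall>(n::nat) (m::nat) S P.
        n \<ge> 1 \<and> m \<ge> 1 \<and> length S = m \<and> deque_sequence n S \<and> greedy n S P \<longrightarrow>
        real (card P) \<le> C * (real m * 2 ^ inv_ackermann m (n + m) + real n))"
proof (intro exI[of _ 178] conjI allI impI)
  fix n m :: nat and S P
  assume A: "n \<ge> 1 \<and> m \<ge> 1 \<and> length S = m \<and> deque_sequence n S \<and> greedy n S P"
  let ?z = "inv_ackermann m (n + m)"
  interpret deque n S using A by unfold_locales simp
  have linear: "2 * Suc z + 2 \<le> 8 * 2 ^ z" for z :: nat by (induction z) auto
  have "Suc m \<le> ackermann (Suc ?z) 5" using less_ackermann_inv[of m n] A by linarith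
  then have "card P \<le> 2 * ((2 * Suc ?z + 2) * m + (4 * 2 ^ Suc ?z - 2) * 5 * Suc m) + m + n"
    using card_greedy[of P "Suc ?z" 5] A by simp
  \<comment> \<open>The linear term \<open>2 * Suc ?z + 2\<close> is absorbed into
    \<open>8 * 2 ^ ?z\<close>. The coefficient of \<open>m * 2 ^ ?z\<close> becomes 16 + 160 + 1 =
    177, which 178 covers.\<close>
  also have "\<dots> \<le> 2 * ((8 * 2 ^ ?z) * m + (8 * 2 ^ ?z) * 5 * (2 * m)) + 2 ^ ?z * m + n"
  proof (intro add_mono mult_le_mono order_refl)
    show "2 * Suc ?z + 2 \<le> 8 * 2 ^ ?z" by (rule linear)
    show "Suc m \<le> 2 * m" using A by simp
    show "m \<le> 2 ^ ?z * m" by simp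
  qed auto
  also have "\<dots> \<le> 178 * (m * 2 ^ ?z + n)" by (simp add: algebra_simps)
  finally have "real (card P) \<le> real (178 * (m * 2 ^ ?z + n))" by (simp only: of_nat_le_iff)
  then show "real (card P) \<le> 178 * (real m * 2 ^ ?z + real n)" by simp
qed simp

end
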